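(* Let $(\xi,\mu,\eta)$ be a linear representation over $\Sigma=\{a_1,\dots,a_\ell,b\}$ satisfying the standing assumptions in the context, such that the matrix $M=A_1+\cdots+A_\ell+B$ is primitive, and let $\lambda$ be its Perron-Frobenius eigenvalue. Let $\mathbf{Y}_n$ be the associated $\mathbb{R}^\ell$-valued symbol statistics, let $y(\mathbf{t})$ be the Perron-Frobenius eigenvalue of $M(\mathbf{t})=A_1e^{t_1}+\cdots+A_\ell e^{t_\ell}+B$, and set $\boldsymbol{\beta}=\frac{\nabla y(\mathbf{0})}{\lambda}$ and $\Gamma=[\gamma_{ij}]_{i,j=1}^\ell$ with $$\gamma_{ij}=\frac{\partial^2\log y}{\partial t_i\partial t_j}(\mathbf{0}).$$ Then $\frac{\mathbf{Y}_n-n\boldsymbol{\beta}}{\sqrt n}$ converges in distribution, as $n\to\infty$, to a random variable $N(\mathbf{0},\Gamma)$.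
   Context: Model. Let $\ell\ge 1$, $m\ge 1$ be integers, $\Sigma=\{a_1,\dots,a_\ell,b\}$ a finite alphabet with $\ell+1$ symbols, $\mathbb{R}_+=[0,\infty)$. Fix column vectors $\xi,\eta\in\mathbb{R}_+^m$ and matrices $A_1,\dots,A_\ell,B\in\mathbb{R}_+^{m\times m}$. Let $\mu$ be the monoid morphism from the set $\Sigma^*$ of all words over $\Sigma$ to $\mathbb{R}_+^{m\times m}$ with $\mu(a_i)=A_i$, $\mu(b)=B$. The triple $(\xi,\mu,\eta)$ is called a linear representation. A prime denotes transposition. Put $M=A_1+\cdots+A_\ell+B$. Standing assumptions: all of $A_1,\dots,A_\ell,B$ are nonzero matrices, and for every sufficiently large $n$ there is a word $w$ of length $n$ with $\xi'\mu(w)\eta>0$ (so $\xi\ne 0\ne\eta$ and $\xi'M^n\eta>0$ for all large $n$). For such $n$, the set $\Sigma^n$ of words of length $n$ carries the probability measure $\Pr(w)=\dfrac{\xi'\mu(w)\eta}{\xi'M^n\eta}$, and $\mathbf{Y}_n=(|w|_{a_1},\dots,|w|_{a_\ell})$, where $w$ is random in $\Sigma^n$ with law $\Pr$ and $|w|_{x}$ is the number of occurrences of $x$ in $w$. Sequences indexed by $n$ are considered for $n$ large enough that $\mathbf{Y}_n$ is defined. A matrix $T\in\mathbb{R}_+^{m\times m}$ is primitive if $T^k$ has all entries strictly positive for some $k\ge 1$; its Perron-Frobenius eigenvalue is its unique eigenvalue of largest modulus, which is real, positive and simple. If $M$ is primitive then $M(\mathbf{t})$ is primitive for all $\mathbf{t}\in\mathbb{R}^\ell$;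 $y(\mathbf{t})$ is a positive function, analytic on $\mathbb{R}^\ell$, with $y(\mathbf{0})=\lambda$. For $\mathbf{m}\in\mathbb{R}^\ell$ and a symmetric positive semidefinite $C\in\mathbb{R}^{\ell\times\ell}$, $N(\mathbf{m},C)$ denotes an $\ell$-variate (possibly degenerate) Gaussian random variable with mean $\mathbf{m}$ and covariance matrix $C$, i.e. with moment generating function $\exp\{\mathbf{m}'\mathbf{t}+\frac12\mathbf{t}'C\mathbf{t}\}$. *)

theory Defs
  imports "HOL-Probability.Probability"
begin

text \<open>Matrices are \<open>real ^ 'm ^ 'm\<close>. Their type-class power \<open>^\<close> would be entrywise,
  so powers with respect to the matrix product need their own definition.\<close>

definition mpow :: "real ^ 'm ^ 'm \<Rightarrow> nat \<Rightarrow> real ^ 'm ^ 'm" where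
  "mpow T n = ((\<lambda>X. T ** X) ^^ n) (mat 1)"

definition primitive :: "real ^ 'm ^ 'm \<Rightarrow> bool" where
  "primitive T \<longleftrightarrow> (\<forall>i j. 0 \<le> T $ i $ j) \<and> (\<exists>k\<ge>1. \<forall>i j. 0 < mpow T k $ i $ j)"

definition ceigenvalue :: "real ^ 'm ^ 'm \<Rightarrow> complex \<Rightarrow> bool" where
  "ceigenvalue T z \<longleftrightarrow>
     (\<exists>v :: complex ^ 'm. v \<noteq> 0 \<and> (\<chi> i j. complex_of_real (T $ i $ j)) *v v = z *s v)"

text \<open>The real number that is the unique eigenvalue of largest modulus among all complex
  eigenvalues; it exists for primitive \<open>T\<close>.\<close>

definition pf_eigenvalue :: "real ^ 'm ^ 'm \<Rightarrow> real" where
  "pf_eigenvalue T =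
     (THE r. ceigenvalue T (of_real r) \<and>
             (\<forall>z. ceigenvalue T z \<and> z \<noteq> of_real r \<longrightarrow> cmod z < cmod (of_real r)))"

definition partial_deriv :: "'l \<Rightarrow> (real ^ 'l \<Rightarrow> real) \<Rightarrow> real ^ 'l \<Rightarrow> real" where
  "partial_deriv i f x = deriv (\<lambda>s. f (x + s *\<^sub>R axis i 1)) 0"

text \<open>The alphabet is \<open>'l option\<close>: \<open>Some i\<close> stands for the letter \<open>a\<^sub>i\<close> and \<open>None\<close> for \<open>b\<close>.\<close>

definition letter_mat ::
    "('l \<Rightarrow> real ^ 'm ^ 'm) \<Rightarrow> real ^ 'm ^ 'm \<Rightarrow> 'l option \<Rightarrow> real ^ 'm ^ 'm" where
  "letter_mat A B x = (case x of Some i \<Rightarrow> A i | None \<Rightarrow> B)"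

definition word_mat ::
    "('l \<Rightarrow> real ^ 'm ^ 'm) \<Rightarrow> real ^ 'm ^ 'm \<Rightarrow> 'l option list \<Rightarrow> real ^ 'm ^ 'm" where
  "word_mat A B w = foldr (\<lambda>x X. letter_mat A B x ** X) w (mat 1)"

definition word_weight ::
    "real ^ 'm \<Rightarrow> ('l \<Rightarrow> real ^ 'm ^ 'm) \<Rightarrow> real ^ 'm ^ 'm \<Rightarrow> real ^ 'm \<Rightarrow> 'l option list \<Rightarrow> real" where
  "word_weight \<xi> A B \<eta> w = \<xi> \<bullet> (word_mat A B w *v \<eta>)"

definition total_mat ::
    "('l \<Rightarrow> real ^ 'm ^ 'm) \<Rightarrow> real ^ 'm ^ 'm \<Rightarrow> real ^ 'm ^ 'm" where
  "total_mat A B = (\<Sum>i\<in>UNIV. A i) + B"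

definition linear_representation ::
    "real ^ 'm \<Rightarrow> ('l \<Rightarrow> real ^ 'm ^ 'm) \<Rightarrow> real ^ 'm ^ 'm \<Rightarrow> real ^ 'm \<Rightarrow> bool" where
  "linear_representation \<xi> A B \<eta> \<longleftrightarrow>
     (\<forall>p. 0 \<le> \<xi> $ p) \<and> (\<forall>p. 0 \<le> \<eta> $ p) \<and>
     (\<forall>i p q. 0 \<le> A i $ p $ q) \<and> (\<forall>p q. 0 \<le> B $ p $ q) \<and>
     (\<forall>i. A i \<noteq> 0) \<and> B \<noteq> 0 \<and>
     (\<forall>\<^sub>F n in sequentially. \<exists>w. length w = n \<and> 0 < word_weight \<xi> A B \<eta> w)"

text \<open>A probability measure as soon as \<open>\<xi>' M^n \<eta> > 0\<close>, hence for all large \<open>n\<close> under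
  \<^const>\<open>linear_representation\<close>.\<close>

definition word_measure ::
    "real ^ 'm \<Rightarrow> ('l \<Rightarrow> real ^ 'm ^ 'm) \<Rightarrow> real ^ 'm ^ 'm \<Rightarrow> real ^ 'm \<Rightarrow> nat
      \<Rightarrow> 'l option list measure" where
  "word_measure \<xi> A B \<eta> n =
     point_measure {w. length w = n}
       (\<lambda>w. ennreal (word_weight \<xi> A B \<eta> w / (\<xi> \<bullet> (mpow (total_mat A B) n *v \<eta>))))"

definition symbol_counts :: "'l option list \<Rightarrow> real ^ 'l" where
  "symbol_counts w = (\<chi> i. real (count_list w (Some i)))"

definition tilted_mat ::
    "('l \<Rightarrow> real ^ 'm ^ 'm) \<Rightarrow> real ^ 'm ^ 'm \<Rightarrow> real ^ 'l \<Rightarrow> real ^ 'm ^ 'm" where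
  "tilted_mat A B t = (\<Sum>i\<in>UNIV. exp (t $ i) *\<^sub>R A i) + B"

text \<open>\<open>N\<close> is the law of a (possibly degenerate) Gaussian vector with mean \<open>c\<close> and covariance
  matrix \<open>C\<close>, specified by its moment generating function.\<close>

definition gaussian_law :: "real ^ 'l \<Rightarrow> real ^ 'l ^ 'l \<Rightarrow> (real ^ 'l) measure \<Rightarrow> bool" where
  "gaussian_law c C N \<longleftrightarrow>
     transpose C = C \<and> (\<forall>t. 0 \<le> t \<bullet> (C *v t)) \<and>
     prob_space N \<and> sets N = sets borel \<and>
     (\<forall>t. integrable N (\<lambda>x. exp (t \<bullet> x)) \<and>
          (\<integral>x. exp (t \<bullet> x) \<partial>N) = exp (c \<bullet> t + 1/2 * (t \<bullet> (C *v t))))"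

text \<open>Convergence in distribution of the random vectors \<open>X n\<close>, each on its own probability
  space \<open>P n\<close>, to the law \<open>N\<close>; the library's \<^const>\<open>weak_conv_m\<close> covers only the real line.\<close>

definition converges_in_distribution ::
    "(nat \<Rightarrow> 'a measure) \<Rightarrow> (nat \<Rightarrow> 'a \<Rightarrow> 'b :: topological_space) \<Rightarrow> 'b measure \<Rightarrow> bool" where
  "converges_in_distribution P X N \<longleftrightarrow>
     (\<forall>f :: 'b \<Rightarrow> real. continuous_on UNIV f \<longrightarrow> bounded (range f) \<longrightarrow>
        (\<lambda>n. \<integral>w. f (X n w) \<partial>(P n)) \<longlonglongrightarrow> (\<integral>x. f x \<partial>N))"

end

theory Submission
  imports Defs "HOL-Complex_Analysis.Great_Picard" "HOL-Real_Asymp.Real_Asymp"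
begin

text \<open>Tilting the letters gives \<open>E exp (t \<bullet> Y_n) = \<xi>' M(t)^n \<eta> / \<xi>' M(0)^n \<eta>\<close>, and \<open>M(t)^n\<close> is
  asymptotic to \<open>y(t)^n\<close> times the spectral projection, uniformly for \<open>t\<close> near \<open>0\<close>. Since \<open>ln y\<close>
  is twice differentiable, its second-order expansion at \<open>t / sqrt n\<close> turns the moment generating
  function of the normalised statistics into \<open>exp (t' \<Gamma> t / 2)\<close> for every real \<open>t\<close>. Normal
  families carry this over to imaginary arguments, that is, to trigonometric polynomials, and
  these approximate bounded continuous functions up to an exponentially weighted error which the
  moment generating functions control.\<close>

section \<open>Perron--Frobenius theory of primitive matrices\<close>

text \<open>Only real tilts enter the matrix part: for complex \<open>t\<close> the matrices leave
  the nonnegative cone, and with it go comparison, positivity and minorisation. The passage to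
  imaginary arguments therefore happens for the scalar transforms, once their real limits are known.
  The tilt \<open>t / sqrt n\<close> and the exponent \<open>n\<close> move together, so a limit
  theorem for the powers of one matrix is not enough. The regularity of \<open>y\<close> comes from
  a bootstrap: \<open>y\<close> is continuous by comparison, hence the eigenvectors are continuous,
  hence \<open>y\<close> is differentiable, hence the eigenvectors are differentiable, and so is the
  gradient of \<open>ln y\<close>, which is expressed through them. As \<Gamma> may be singular, the
  limit law is built from standard normals and not from a density; its exponential and cosine
  integrals are recorded together, which identifies the limit without a uniqueness theorem for
  transforms.\<close>

lemma mpow_0 [simp]: "mpow T 0 = mat 1"
  by (simp add: mpow_def)

lemma mpow_Suc: "mpow T (Suc n) = T ** mpow T n"
  by (simp add: mpow_def)

lemma mpow_add: "mpow T (a + b) = mpow T a ** mpow T b"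
  by (induction a) (simp_all add: mpow_Suc matrix_mul_assoc)

lemma mpow_1 [simp]: "mpow T (Suc 0) = T"
  by (simp add: mpow_Suc)

lemma mpow_Suc_right: "mpow T (Suc n) = mpow T n ** T"
  using mpow_add[of T n 1] by simp

lemma transpose_mpow: "transpose (mpow T n) = mpow (transpose T) n"
  for T :: "real ^ 'm ^ 'm"
  by (induction n) (simp_all add: mpow_Suc_right[of T] mpow_Suc[of "transpose T"] matrix_transpose_mul)

text \<open>The factor \<open>c\<close> serves the comparison of two tilts, which dominate each
  other entrywise up to a constant: positivity and lower bounds for a fixed power pass from one tilt
  to the other at the price \<open>c ^ n\<close>.\<close>

lemma mpow_mono:
  fixes S T :: "real ^ 'm ^ 'm"
  assumes "\<And>i j. 0 \<le> S $ i $ j" "\<And>i j. S $ i $ j \<le> c * T $ i $ j" "0 \<le> c"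
  shows "0 \<le> mpow S n $ i $ j \<and> mpow S n $ i $ j \<le> c ^ n * mpow T n $ i $ j"
proof (induction n arbitrary: i j)
  case 0
  show ?case by (simp add: mat_def)
next
  case (Suc n)
  have *: "0 \<le> S $ i $ k * mpow S n $ k $ j"
    "S $ i $ k * mpow S n $ k $ j \<le> (c * T $ i $ k) * (c ^ n * mpow T n $ k $ j)" for k
    using Suc[of k j] assms(1)[of i k] assms(2)[of i k]
    by (auto intro!: mult_mono intro: order_trans)
  show ?case
    unfolding mpow_Suc matrix_matrix_mult_def
    using sum_mono[of UNIV "\<lambda>k. S $ i $ k * mpow S n $ k $ j", OF *(2)]
      sum_nonneg[of UNIV "\<lambda>k. S $ i $ k * mpow S n $ k $ j", OF *(1)]
    by (simp add: sum_distrib_left mult_ac)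
qed

lemma mpow_nonneg: "(\<And>i j. 0 \<le> T $ i $ j) \<Longrightarrow> 0 \<le> mpow T n $ i $ j"
  for T :: "real ^ 'm ^ 'm"
  using mpow_mono[of T 1 T] by simp

lemma mpow_eigenvector:
  fixes T :: "real ^ 'm ^ 'm"
  assumes "T *v v = r *\<^sub>R v"
  shows "mpow T n *v v = r ^ n *\<^sub>R v"
  by (induction n)
    (simp_all add: mpow_Suc matrix_vector_mul_assoc[symmetric] matrix_vector_mult_scaleR assms mult.commute)

lemma inner_vec_sum: "x \<bullet> y = (\<Sum>i\<in>UNIV. x $ i * y $ i)" for x y :: "real ^ 'm"
  by (simp add: inner_vec_def)

lemma inner_pos_vec: "(\<And>i. 0 < x $ i) \<Longrightarrow> (\<And>i. 0 < y $ i) \<Longrightarrow> 0 < x \<bullet> y" for x y :: "real ^ 'm"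
  unfolding inner_vec_sum by (intro sum_pos) auto

lemma uniform_positive_lower_bound:
  fixes f :: "'a::finite \<Rightarrow> 'b::finite \<Rightarrow> real"
  assumes "\<And>i j. 0 < f i j"
  obtains e where "0 < e" "\<And>i j. e \<le> f i j"
proof
  let ?R = "range (\<lambda>(i, j). f i j)"
  have "Min ?R \<in> ?R" by (intro Min_in) auto
  then show "0 < Min ?R" using assms by force
  show "Min ?R \<le> f i j" for i j by (intro Min_le) (auto intro: image_eqI[of _ _ "(i, j)"])
qed

text \<open>Normalising each vector to sum 1, instead of \<open>u \<bullet> v = 1\<close>, keeps the
  notion symmetric under transposition, bounds all entries by 1 and makes \<open>v\<close> the
  solution of an inhomogeneous linear system. The price is the denominator
  \<open>u \<bullet> v\<close> in the spectral projection.\<close>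

definition perron :: "real ^ 'm ^ 'm \<Rightarrow> real \<Rightarrow> real ^ 'm \<Rightarrow> real ^ 'm \<Rightarrow> bool" where
  "perron T r u v \<longleftrightarrow> (\<forall>i j. 0 \<le> T $ i $ j) \<and> 0 < r \<and> (\<forall>i. 0 < u $ i) \<and> (\<forall>i. 0 < v $ i) \<and>
     T *v v = r *\<^sub>R v \<and> transpose T *v u = r *\<^sub>R u \<and>
     (\<Sum>i\<in>UNIV. u $ i) = 1 \<and> (\<Sum>i\<in>UNIV. v $ i) = 1"

lemma perron_transpose: "perron T r u v \<Longrightarrow> perron (transpose T) r v u"
  by (auto simp: perron_def transpose_def)

lemma perronD:
  assumes "perron T r u v"
  shows "0 \<le> T $ i $ j" "0 < r" "0 < u $ i" "0 < v $ i" "T *v v = r *\<^sub>R v"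
    "transpose T *v u = r *\<^sub>R u" "(\<Sum>i\<in>UNIV. u $ i) = 1" "(\<Sum>i\<in>UNIV. v $ i) = 1"
    "0 < u \<bullet> v" "v $ i \<le> 1" "u $ i \<le> 1"
proof -
  show "v $ i \<le> 1" "u $ i \<le> 1"
    using assms member_le_sum[of i UNIV "\<lambda>i. v $ i"] member_le_sum[of i UNIV "\<lambda>i. u $ i"]
    by (auto simp: perron_def less_imp_le)
qed (use assms in \<open>auto simp: perron_def intro!: inner_pos_vec\<close>)

lemma primitive_transpose: "primitive T \<Longrightarrow> primitive (transpose T)"
  unfolding primitive_def transpose_mpow[symmetric] by (simp add: transpose_def) blast

text \<open>Brouwer's theorem on the standard simplex, applied to \<open>T x\<close> rescaled to sum
  1: a fixed point is an eigenvector. Positivity of \<open>T^k\<close> shows that the rescaling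
  never divides by 0 and that the fixed point has no zero entry.\<close>

lemma primitive_eigenvector:
  fixes T :: "real ^ 'm ^ 'm"
  assumes "primitive T"
  obtains r v where "0 < r" "\<And>i. 0 < v $ i" "(\<Sum>i\<in>UNIV. v $ i) = 1" "T *v v = r *\<^sub>R v"
proof -
  from assms obtain k where T0: "\<And>i j. 0 \<le> T $ i $ j" and k: "k \<ge> 1" "\<And>i j. 0 < mpow T k $ i $ j"
    by (auto simp: primitive_def)
  obtain l where l: "k = Suc l" using k by (cases k) auto
  define S where "S = {x :: real ^ 'm. (\<forall>i. 0 \<le> x $ i) \<and> (\<Sum>i\<in>UNIV. x $ i) = 1}"
  have pos: "0 < (mpow T k *v x) $ i" if "x \<in> S" for x i
  proof -
    have "\<exists>j. x $ j \<noteq> 0"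
    proof (rule ccontr)
      assume "\<not> ?thesis"
      then have "(\<Sum>j\<in>UNIV. x $ j) = 0" by simp
      then show False using that by (simp add: S_def)
    qed
    then obtain j where "x $ j \<noteq> 0" by blast
    then have "0 < x $ j" using that by (simp add: S_def less_le)
    then show ?thesis
      unfolding matrix_vector_mult_def using k that
      by (auto simp: S_def less_imp_le intro!: sum_pos2[of _ j])
  qed
  have Tx0: "0 \<le> (T *v x) $ i" if "x \<in> S" for x i
    using that T0 by (auto simp: matrix_vector_mult_def S_def intro!: sum_nonneg)
  have spos: "0 < (\<Sum>i\<in>UNIV. (T *v x) $ i)" if "x \<in> S" for x
  proof (rule ccontr)
    assume "\<not> ?thesis"
    then have "(\<Sum>i\<in>UNIV. (T *v x) $ i) = 0"
      using Tx0[OF that] sum_nonneg[of UNIV "\<lambda>i. (T *v x) $ i"] by simp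
    then have "T *v x = 0" using Tx0[OF that] by (simp add: sum_nonneg_eq_0_iff vec_eq_iff)
    then have "mpow T k *v x = 0" by (simp add: l mpow_Suc_right matrix_vector_mul_assoc[symmetric])
    then show False using pos[OF that] by (metis less_irrefl zero_index)
  qed
  define f where "f x = (1 / (\<Sum>i\<in>UNIV. (T *v x) $ i)) *\<^sub>R (T *v x)" for x
  have "bounded S"
    unfolding bounded_iff
    by (intro exI[of _ 1] ballI order_trans[OF norm_le_l1_cart]) (simp add: S_def)
  moreover have "closed S"
    unfolding S_def by (intro closed_Collect_conj closed_Collect_all closed_Collect_le closed_Collect_eq continuous_intros)
  ultimately have "compact S" by (simp add: compact_eq_bounded_closed)
  moreover have "convex S"
    unfolding convex_def S_def
    by (auto simp: sum.distrib sum_distrib_left[symmetric])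
  moreover have "axis undefined 1 \<in> S"
    by (auto simp: S_def axis_def)
  moreover have "continuous_on S f"
  proof -
    have nz: "\<forall>x\<in>S. (\<Sum>i\<in>UNIV. (T *v x) $ i) \<noteq> 0"
      using spos by (metis less_irrefl)
    have c: "continuous_on S (\<lambda>x. T *v x)"
      by (rule matrix_vector_mult_linear_continuous_on)
    have "continuous_on S (\<lambda>x. \<Sum>i\<in>UNIV. (T *v x) $ i)"
      by (intro continuous_on_sum continuous_on_component c)
    with nz show ?thesis
      unfolding f_def by (intro continuous_on_scaleR[OF continuous_on_divide[OF continuous_on_const] c])
  qed
  moreover have "f \<in> S \<rightarrow> S"
  proof
    fix x assume x: "x \<in> S"
    have "(\<Sum>i\<in>UNIV. f x $ i) = 1"
      using spos[OF x] by (simp add: f_def sum_divide_distrib[symmetric])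
    moreover have "0 \<le> f x $ i" for i
      using spos[OF x] Tx0[OF x, of i] by (simp add: f_def)
    ultimately show "f x \<in> S" by (simp add: S_def)
  qed
  ultimately obtain v where v: "v \<in> S" "f v = v"
    using brouwer[of S f] by blast
  define r where "r = (\<Sum>i\<in>UNIV. (T *v v) $ i)"
  have r: "r > 0" using spos[OF v(1)] by (simp add: r_def)
  have "T *v v = r *\<^sub>R f v" using r by (simp add: f_def r_def)
  then have eig: "T *v v = r *\<^sub>R v" using v by simp
  have "0 < v $ i" for i
    using pos[OF v(1), of i] r unfolding mpow_eigenvector[OF eig]
    by (simp add: zero_less_mult_iff)
  then show ?thesis using that[of r v] r eig v by (auto simp: S_def)
qed

lemma inner_mpow_eigenvector:
  fixes T :: "real ^ 'm ^ 'm"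
  assumes "transpose T *v u = r *\<^sub>R u"
  shows "u \<bullet> (mpow T n *v x) = r ^ n * (u \<bullet> x)"
proof -
  have "u \<bullet> (mpow T n *v x) = (mpow (transpose T) n *v u) \<bullet> x"
    by (metis dot_lmul_matrix transpose_matrix_vector transpose_mpow transpose_transpose)
  then show ?thesis using mpow_eigenvector[OF assms] by simp
qed

text \<open>The right and the left eigenvector come with eigenvalues \<open>r\<close> and
  \<open>q\<close> that are unrelated at first; computing \<open>u \<bullet> (T *v v)\<close> in
  both ways identifies them because \<open>u \<bullet> v > 0\<close>.\<close>

lemma primitive_imp_perron:
  fixes T :: "real ^ 'm ^ 'm"
  assumes "primitive T"
  obtains r u v where "perron T r u v"
proof -
  obtain r v where v: "0 < r" "\<And>i. 0 < v $ i" "(\<Sum>i\<in>UNIV. v $ i) = 1" "T *v v = r *\<^sub>R v"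
    using primitive_eigenvector[OF assms] by blast
  obtain q u where u: "0 < q" "\<And>i. 0 < u $ i" "(\<Sum>i\<in>UNIV. u $ i) = 1" "transpose T *v u = q *\<^sub>R u"
    using primitive_eigenvector[OF primitive_transpose[OF assms]] by blast
  have "q * (u \<bullet> v) = r * (u \<bullet> v)"
    using inner_mpow_eigenvector[OF u(4), of 1 v] unfolding v(4) mpow_1 One_nat_def by auto
  moreover have "u \<bullet> v \<noteq> 0" using inner_pos_vec[of u v] u v by simp
  ultimately have "q = r" by (metis mult_right_cancel)
  then show ?thesis using that[of r u v] u v assms by (auto simp: perron_def primitive_def)
qed

section \<open>Contraction in the \<open>v\<close>-weighted sup norm and convergence of
  powers\<close>

lemma abs_matrix_vector_le:
  fixes T :: "real ^ 'm ^ 'm"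
  assumes "\<And>j. 0 \<le> T $ i $ j" "\<And>j. \<bar>x $ j\<bar> \<le> c * v $ j"
  shows "\<bar>(T *v x) $ i\<bar> \<le> c * (T *v v) $ i"
proof -
  have "\<bar>(T *v x) $ i\<bar> \<le> (\<Sum>j\<in>UNIV. \<bar>T $ i $ j * x $ j\<bar>)"
    unfolding matrix_vector_mult_def by simp
  also have "\<dots> \<le> (\<Sum>j\<in>UNIV. T $ i $ j * (c * v $ j))"
    by (intro sum_mono) (use assms in \<open>auto simp: abs_mult intro!: mult_left_mono\<close>)
  finally show ?thesis by (simp add: matrix_vector_mult_def sum_distrib_left mult_ac)
qed

lemma perron_mpow_abs_le:
  assumes "perron T r u v" "\<And>j. \<bar>x $ j\<bar> \<le> c * v $ j"
  shows "\<bar>(mpow T n *v x) $ i\<bar> \<le> r ^ n * c * v $ i"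
  using abs_matrix_vector_le[of "mpow T n" i x c v] assms(2) mpow_nonneg[of T n, OF perronD(1)[OF assms(1)]]
  unfolding mpow_eigenvector[OF perronD(5)[OF assms(1)]] by (simp add: mult_ac)

text \<open>Doeblin minorisation: on the hyperplane \<open>u \<bullet> x = 0\<close> the rank-one part \<open>\<delta> r^k v u'\<close> may be
  subtracted from \<open>T^k\<close> without changing \<open>T^k x\<close>, which leaves a nonnegative matrix that
  contracts the \<open>v\<close>-weighted sup norm.\<close>

lemma perron_contraction_step:
  assumes P: "perron T r u v"
    and minor: "\<And>i j. \<delta> * r ^ k * (v $ i * u $ j) \<le> mpow T k $ i $ j"
    and x: "u \<bullet> x = 0" "\<And>j. \<bar>x $ j\<bar> \<le> c * v $ j"
  shows "\<bar>(mpow T k *v x) $ i\<bar> \<le> r ^ k * ((1 - \<delta> * (u \<bullet> v)) * c) * v $ i"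
proof -
  define S where "S = (\<chi> i j. mpow T k $ i $ j - \<delta> * r ^ k * (v $ i * u $ j))"
  have S: "(S *v z) $ i = (mpow T k *v z) $ i - \<delta> * r ^ k * v $ i * (u \<bullet> z)" for z
    by (simp add: S_def matrix_vector_mult_def inner_vec_sum sum_subtractf sum_distrib_left algebra_simps)
  have "\<bar>(S *v x) $ i\<bar> \<le> c * (S *v v) $ i"
    by (intro abs_matrix_vector_le) (use minor x in \<open>auto simp: S_def\<close>)
  then show ?thesis
    unfolding S x mpow_eigenvector[OF perronD(5)[OF P]] by (simp add: algebra_simps)
qed

text \<open>The hyperplane is invariant under \<open>T\<close>, so the \<open>k\<close>-step
  contraction can be applied \<open>n div k\<close> times; the \<open>n mod k\<close> steps left
  over cost only a factor \<open>r\<close> each.\<close>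

lemma perron_contraction:
  assumes P: "perron T r u v"
    and minor: "\<And>i j. \<delta> * r ^ k * (v $ i * u $ j) \<le> mpow T k $ i $ j"
    and x: "u \<bullet> x = 0" "\<And>j. \<bar>x $ j\<bar> \<le> c * v $ j"
  shows "\<bar>(mpow T n *v x) $ i\<bar> \<le> r ^ n * ((1 - \<delta> * (u \<bullet> v)) ^ (n div k) * c) * v $ i"
proof -
  have *: "u \<bullet> (mpow T m *v x) = 0" for m
    using inner_mpow_eigenvector[OF perronD(6)[OF P]] x by simp
  let ?\<rho> = "1 - \<delta> * (u \<bullet> v)"
  have iter: "\<bar>(mpow T (q * k) *v x) $ i\<bar> \<le> r ^ (q * k) * (?\<rho> ^ q * c) * v $ i" for q i
  proof (induction q arbitrary: i)
    case 0
    then show ?case using x by simp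
  next
    case (Suc q)
    have "mpow T (Suc q * k) *v x = mpow T k *v (mpow T (q * k) *v x)"
      by (simp add: mpow_add matrix_vector_mul_assoc)
    then show ?case
      using perron_contraction_step[OF P minor *, of "q * k" "r ^ (q * k) * (?\<rho> ^ q * c)" i] Suc
      by (simp add: power_add mult_ac)
  qed
  have "mpow T n *v x = mpow T (n mod k) *v (mpow T (n div k * k) *v x)"
    by (simp add: mpow_add[symmetric] matrix_vector_mul_assoc)
  moreover have "r ^ n = r ^ (n mod k) * r ^ (n div k * k)"
    by (simp add: power_add[symmetric])
  ultimately show ?thesis
    using perron_mpow_abs_le[OF P iter, of "n mod k" "n div k" i] by (simp only: mult.assoc)
qed

text \<open>Subtracting the spectral projection \<open>a v\<close> moves \<open>x\<close> into the
  hyperplane. The factor 2 arises because \<open>x\<close> and \<open>a v\<close> are both bounded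
  by \<open>c v\<close>. The bound is explicit so that it can be used for a matrix that changes with
  \<open>n\<close>.\<close>

lemma perron_rate:
  assumes P: "perron T r u v"
    and minor: "\<And>i j. \<delta> * r ^ k * (v $ i * u $ j) \<le> mpow T k $ i $ j"
    and x: "\<And>j. \<bar>x $ j\<bar> \<le> c * v $ j"
  shows "\<bar>(mpow T n *v x) $ i / r ^ n - (u \<bullet> x) / (u \<bullet> v) * v $ i\<bar>
      \<le> (1 - \<delta> * (u \<bullet> v)) ^ (n div k) * (2 * c) * v $ i"
proof -
  note D = perronD[OF P]
  define a where "a = (u \<bullet> x) / (u \<bullet> v)"
  have "\<bar>u \<bullet> x\<bar> \<le> (\<Sum>i\<in>UNIV. u $ i * (c * v $ i))"
    unfolding inner_vec_sum
    by (intro order_trans[OF sum_abs] sum_mono) (use x D in \<open>auto simp: abs_mult less_imp_le intro!: mult_left_mono\<close>)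
  then have "\<bar>u \<bullet> x\<bar> \<le> c * (u \<bullet> v)"
    by (simp add: inner_vec_sum sum_distrib_left mult_ac)
  then have a: "\<bar>a\<bar> \<le> c" using D(9) by (simp add: a_def abs_div field_simps)
  define z where "z = x - a *\<^sub>R v"
  have "u \<bullet> z = 0" using D(9) by (simp add: z_def a_def inner_diff_right)
  moreover have "\<bar>z $ j\<bar> \<le> 2 * c * v $ j" for j
  proof -
    have "\<bar>z $ j\<bar> \<le> \<bar>x $ j\<bar> + \<bar>a\<bar> * v $ j"
      using D(4)[of j] abs_triangle_ineq4[of "x $ j" "a * v $ j"] by (simp add: z_def abs_mult)
    also have "\<dots> \<le> c * v $ j + c * v $ j"
      using x[of j] a D(4)[of j] by (intro add_mono mult_right_mono) auto
    finally show ?thesis by simp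
  qed
  ultimately have "\<bar>(mpow T n *v z) $ i\<bar> \<le> r ^ n * ((1 - \<delta> * (u \<bullet> v)) ^ (n div k) * (2 * c)) * v $ i"
    by (rule perron_contraction[OF P minor])
  moreover have "(mpow T n *v z) $ i = r ^ n * ((mpow T n *v x) $ i / r ^ n - a * v $ i)"
    using D(2) by (simp add: z_def matrix_vector_mult_diff_distrib matrix_vector_mult_scaleR
        mpow_eigenvector[OF D(5)] algebra_simps)
  ultimately show ?thesis
    using D(2) by (simp add: abs_mult a_def mult.assoc)
qed

text \<open>Matrix and exponent run together here, as they do for the tilts
  \<open>t / sqrt n\<close>. Convergent eigenvectors with positive limits and one minorisation
  constant for all large \<open>n\<close> keep the contraction factor away from 1.\<close>

lemma perron_power_limit_sequence:
  fixes u v :: "nat \<Rightarrow> real ^ 'm"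
  assumes P: "\<And>n. perron (T n) (r n) (u n) (v n)"
    and lim: "u \<longlonglongrightarrow> u0" "v \<longlonglongrightarrow> v0" and pos: "\<And>i. 0 < u0 $ i" "\<And>i. 0 < v0 $ i"
    and k: "k \<ge> 1" and e: "0 < e" "\<forall>\<^sub>F n in sequentially. \<forall>i j. e * r n ^ k \<le> mpow (T n) k $ i $ j"
  shows "(\<lambda>n. (mpow (T n) n *v x) $ i / r n ^ n) \<longlonglongrightarrow> (u0 \<bullet> x) / (u0 \<bullet> v0) * v0 $ i"
proof -
  have uv: "0 < u0 \<bullet> v0" using pos by (rule inner_pos_vec)
  obtain m where m: "0 < m" "\<And>j. m \<le> v0 $ j"
    using uniform_positive_lower_bound[of "\<lambda>(_::unit) j. v0 $ j"] pos by metis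
  \<comment> \<open>Eventually every entry of \<open>v n\<close> is at least \<open>m / 2\<close>,
    and then \<open>norm x = c * (m / 2)\<close> bounds the entries of \<open>x\<close> by
    \<open>c * v n\<close>.\<close>
  define c where "c = 2 * norm x / m"
  have "\<forall>\<^sub>F n in sequentially. \<forall>j. m / 2 \<le> v n $ j"
  proof (rule eventually_all_finite)
    fix j
    have "(\<lambda>n. v n $ j) \<longlonglongrightarrow> v0 $ j" using lim(2) by (rule tendsto_vec_nth)
    moreover have "m / 2 < v0 $ j" using m(1) m(2)[of j] by linarith
    ultimately have "\<forall>\<^sub>F n in sequentially. m / 2 < v n $ j"
      by (rule order_tendstoD(1))
    then show "\<forall>\<^sub>F n in sequentially. m / 2 \<le> v n $ j"
      by eventually_elim simp
  qed
  moreover have "(\<lambda>n. u n \<bullet> v n) \<longlonglongrightarrow> u0 \<bullet> v0"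
    using lim by (intro tendsto_intros)
  then have "\<forall>\<^sub>F n in sequentially. (u0 \<bullet> v0) / 2 < u n \<bullet> v n"
    using uv by (intro order_tendstoD(1)) auto
  moreover note e(2)
  \<comment> \<open>The rate is frozen at half the limit of \<open>u n \<bullet> v n\<close>, which
    gives one base for all large \<open>n\<close>; the absolute value makes it nonnegative before it
    is known to be less than 1.\<close>
  ultimately have "\<forall>\<^sub>F n in sequentially.
      norm ((mpow (T n) n *v x) $ i / r n ^ n - (u n \<bullet> x) / (u n \<bullet> v n) * v n $ i)
      \<le> \<bar>1 - e * ((u0 \<bullet> v0) / 2)\<bar> ^ (n div k) * (2 * c)"
  proof eventually_elim
    case (elim n)
    note D = perronD[OF P[of n]]
    have minor: "e * r n ^ k * (v n $ i * u n $ j) \<le> mpow (T n) k $ i $ j" for i j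
    proof -
      have "v n $ i * u n $ j \<le> 1 * 1" using D by (intro mult_mono) (auto simp: less_imp_le)
      then have "e * r n ^ k * (v n $ i * u n $ j) \<le> e * r n ^ k * 1"
        using e D by (intro mult_left_mono) auto
      then show ?thesis using elim(3) by (metis mult.right_neutral order_trans)
    qed
    have x: "\<bar>x $ j\<bar> \<le> c * v n $ j" for j
    proof -
      have "c * (m / 2) \<le> c * v n $ j" using elim(1) m by (intro mult_left_mono) (auto simp: c_def)
      then show ?thesis using component_le_norm_cart[of x j] m by (simp add: c_def)
    qed
    have c0: "c \<ge> 0" using m by (simp add: c_def)
    \<comment> \<open>Powers are monotone in nonnegative bases. Applying the minorisation to
      \<open>v n\<close> gives \<open>e r^k v (u \<bullet> v) \<le> T^k v = r^k v\<close>, and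
      dividing by \<open>r^k v\<close> gives the claim.\<close>
    have "0 \<le> (1 - e * (u n \<bullet> v n))"
    proof -
      have "\<bar>(mpow (T n) k *v v n) $ i\<bar> \<ge> e * r n ^ k * v n $ i * (u n \<bullet> v n)"
      proof -
        have "e * r n ^ k * v n $ i * (u n \<bullet> v n) = (\<Sum>j\<in>UNIV. (e * r n ^ k * (v n $ i * u n $ j)) * v n $ j)"
          by (simp add: inner_vec_sum sum_distrib_left mult_ac)
        also have "\<dots> \<le> (\<Sum>j\<in>UNIV. mpow (T n) k $ i $ j * v n $ j)"
          using minor D by (intro sum_mono mult_right_mono) (auto simp: less_imp_le)
        finally show ?thesis by (simp add: matrix_vector_mult_def)
      qed
      then have "(r n ^ k * v n $ i) * (e * (u n \<bullet> v n)) \<le> (r n ^ k * v n $ i) * 1"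
        using D(2) D(4)[of i] by (simp add: mpow_eigenvector[OF D(5)] mult_ac abs_mult)
      then show ?thesis using D(2) D(4)[of i] by (simp add: mult_le_cancel_left_pos)
    qed
    then have "(1 - e * (u n \<bullet> v n)) ^ (n div k) \<le> \<bar>1 - e * ((u0 \<bullet> v0) / 2)\<bar> ^ (n div k)"
      using elim(2) e(1) by (intro power_mono) (auto intro!: order_trans[OF _ abs_ge_self])
    then have "(1 - e * (u n \<bullet> v n)) ^ (n div k) * (2 * c) * v n $ i
        \<le> \<bar>1 - e * ((u0 \<bullet> v0) / 2)\<bar> ^ (n div k) * (2 * c) * 1"
      using c0 D(4)[of i] D(10)[of i] by (intro mult_mono) auto
    then show ?case using perron_rate[OF P minor x, where n = n and i = i] by simp
  qed
  moreover have "(\<lambda>n. \<bar>1 - e * ((u0 \<bullet> v0) / 2)\<bar> ^ (n div k) * (2 * c)) \<longlonglongrightarrow> 0"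
  proof -
    note D = perronD[OF P]
    obtain n where n: "(u0 \<bullet> v0) / 2 < u n \<bullet> v n" "\<forall>i j. e * r n ^ k \<le> mpow (T n) k $ i $ j"
    proof -
      have "\<forall>\<^sub>F n in sequentially. (u0 \<bullet> v0) / 2 < u n \<bullet> v n \<and> (\<forall>i j. e * r n ^ k \<le> mpow (T n) k $ i $ j)"
        using \<open>\<forall>\<^sub>F n in sequentially. (u0 \<bullet> v0) / 2 < u n \<bullet> v n\<close> e(2) by (rule eventually_conj)
      then show ?thesis using that eventually_happens'[OF sequentially_bot] by blast
    qed
    have "e * r n ^ k * (\<Sum>j\<in>UNIV. v n $ j) \<le> (mpow (T n) k *v v n) $ i"
      unfolding sum_distrib_left matrix_vector_mult_def
      using n(2) D(4) by (auto intro!: sum_mono mult_right_mono simp: less_imp_le)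
    then have "e * r n ^ k \<le> r n ^ k * v n $ i"
      by (simp add: mpow_eigenvector[OF D(5)] D(8))
    then have "e \<le> v n $ i" using D(2)[of n] by (simp add: mult.commute)
    then have "e \<le> 1" using D(10)[of n i] by linarith
    moreover have "u n \<bullet> v n \<le> 1"
    proof -
      have "u n \<bullet> v n \<le> (\<Sum>i\<in>UNIV. u n $ i * 1)"
        unfolding inner_vec_sum using D by (intro sum_mono mult_left_mono) (auto simp: less_imp_le)
      then show ?thesis using D(7) by simp
    qed
    ultimately have "e * ((u0 \<bullet> v0) / 2) \<le> 1 * 1"
      using n(1) e(1) uv by (intro mult_mono) auto
    then have "\<bar>1 - e * ((u0 \<bullet> v0) / 2)\<bar> < 1" using e(1) uv by (auto simp: abs_if)
    then have "(\<lambda>n. \<bar>1 - e * ((u0 \<bullet> v0) / 2)\<bar> ^ n) \<longlonglongrightarrow> 0" by (intro LIMSEQ_power_zero) auto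
    moreover have "filterlim (\<lambda>n. n div k) sequentially sequentially"
    using k by (intro filterlim_at_top_div_const_nat) auto
    ultimately show ?thesis
      by (intro tendsto_mult_left_zero) (rule filterlim_compose)
  qed
  ultimately have "(\<lambda>n. (mpow (T n) n *v x) $ i / r n ^ n - (u n \<bullet> x) / (u n \<bullet> v n) * v n $ i) \<longlonglongrightarrow> 0"
    by (rule Lim_null_comparison)
  from tendsto_add[OF this, of "\<lambda>n. (u n \<bullet> x) / (u n \<bullet> v n) * v n $ i"]
  show ?thesis
    using lim uv by (simp add: tendsto_divide tendsto_inner tendsto_mult tendsto_vec_nth)
qed

lemma primitive_power_limit:
  assumes prim: "primitive T" and P: "perron T r u v"
  shows "(\<lambda>n. (mpow T n *v x) $ i / r ^ n) \<longlonglongrightarrow> (u \<bullet> x) / (u \<bullet> v) * v $ i"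
proof -
  note D = perronD[OF P]
  obtain k where k: "k \<ge> 1" "\<And>i j. 0 < mpow T k $ i $ j"
    using prim by (auto simp: primitive_def)
  obtain e where e: "0 < e" "\<And>i j. e \<le> mpow T k $ i $ j"
    using uniform_positive_lower_bound[of "\<lambda>i j. mpow T k $ i $ j"] k(2) by metis
  show ?thesis
    using P k(1) e D by (intro perron_power_limit_sequence[where e = "e / r ^ k" and k = k]) auto
qed

section \<open>Dominance and simplicity of the eigenvalue\<close>

lemma complex_power_convergent_imp:
  fixes z :: complex
  assumes "(\<lambda>n. z ^ n) \<longlonglongrightarrow> l"
  shows "z = 1 \<or> cmod z < 1"
proof (rule ccontr)
  assume *: "\<not> ?thesis"
  \<comment> \<open>Consecutive differences \<open>z^n (z - 1)\<close> tend to 0, but their modulus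
    is at least that of \<open>z - 1\<close> when \<open>z\<close> lies on or outside the unit
    circle.\<close>
  have "(\<lambda>n. z ^ Suc n - z ^ n) \<longlonglongrightarrow> l - l"
    using assms by (intro tendsto_diff LIMSEQ_Suc)
  then have "(\<lambda>n. cmod (z ^ n * (z - 1))) \<longlonglongrightarrow> 0"
    by (simp add: algebra_simps tendsto_norm_zero)
  moreover have "cmod (z - 1) \<le> cmod (z ^ n * (z - 1))" for n
    using * by (simp add: norm_mult norm_power mult_le_cancel_right1 one_le_power)
  ultimately have "cmod (z - 1) \<le> 0"
    by (intro LIMSEQ_le_const) auto
  then show False using * by simp
qed

lemma ceigenvalue_of_real:
  fixes T :: "real ^ 'm ^ 'm"
  assumes "T *v v = r *\<^sub>R v" "v \<noteq> 0"
  shows "ceigenvalue T (of_real r)"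
  unfolding ceigenvalue_def
proof (intro exI conjI)
  let ?w = "(\<chi> i. complex_of_real (v $ i))"
  show "?w \<noteq> 0" using assms(2) by (simp add: vec_eq_iff)
  have "(\<Sum>j\<in>UNIV. T $ i $ j * v $ j) = r * v $ i" for i
    using assms(1) by (simp add: vec_eq_iff matrix_vector_mult_def)
  then have "(\<Sum>j\<in>UNIV. complex_of_real (T $ i $ j) * of_real (v $ j)) = of_real (r * v $ i)" for i
    by (metis (no_types, lifting) of_real_mult of_real_sum sum.cong)
  then show "(\<chi> i j. complex_of_real (T $ i $ j)) *v ?w = of_real r *s ?w"
    by (simp add: vec_eq_iff matrix_vector_mult_def)
qed

text \<open>The real and imaginary parts of \<open>z^n w\<close> are orbits of \<open>T\<close> on
  real vectors, so after division by \<open>r^n\<close> they converge. Thus \<open>(z / r)^n\<close>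
  converges, which leaves only \<open>z = r\<close> or \<open>cmod z < r\<close>.\<close>

lemma perron_dominant:
  assumes prim: "primitive T" and P: "perron T r u v" and z: "ceigenvalue T z" "z \<noteq> of_real r"
  shows "cmod z < r"
proof -
  note D = perronD[OF P]
  obtain w :: "complex ^ 'a" where w: "w \<noteq> 0" "(\<chi> i j. complex_of_real (T $ i $ j)) *v w = z *s w"
    using z(1) by (auto simp: ceigenvalue_def)
  have wi: "(\<Sum>j\<in>UNIV. complex_of_real (T $ i $ j) * w $ j) = z * w $ i" for i
    using w(2) by (simp add: vec_eq_iff matrix_vector_mult_def)
  define a b where "a n = (\<chi> i. Re (z ^ n * w $ i))" and "b n = (\<chi> i. Im (z ^ n * w $ i))" for n
  have step: "(\<Sum>j\<in>UNIV. complex_of_real (T $ i $ j) * (z ^ n * w $ j)) = z ^ Suc n * w $ i" for i n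
  proof -
    have "(\<Sum>j\<in>UNIV. complex_of_real (T $ i $ j) * (z ^ n * w $ j)) =
        z ^ n * (\<Sum>j\<in>UNIV. complex_of_real (T $ i $ j) * w $ j)"
      by (simp add: sum_distrib_left mult_ac)
    then show ?thesis unfolding wi by (simp add: mult_ac)
  qed
  have ab: "T *v a n = a (Suc n)" "T *v b n = b (Suc n)" for n
  proof -
    have "T $ i $ j * Re x = Re (complex_of_real (T $ i $ j) * x)"
      "T $ i $ j * Im x = Im (complex_of_real (T $ i $ j) * x)" for i j x
      by simp_all
    then show "T *v a n = a (Suc n)" "T *v b n = b (Suc n)"
      unfolding vec_eq_iff matrix_vector_mult_def a_def b_def vec_lambda_beta
      by (simp_all only: Re_sum[symmetric] Im_sum[symmetric] step simp_thms)
  qed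
  have "mpow T n *v a 0 = a n" "mpow T n *v b 0 = b n" for n
    by (induction n) (simp_all add: mpow_Suc matrix_vector_mul_assoc[symmetric] ab)
  then have lim: "(\<lambda>n. a n $ i / r ^ n) \<longlonglongrightarrow> (u \<bullet> a 0) / (u \<bullet> v) * v $ i"
    "(\<lambda>n. b n $ i / r ^ n) \<longlonglongrightarrow> (u \<bullet> b 0) / (u \<bullet> v) * v $ i" for i
    using primitive_power_limit[OF prim P, of "a 0" i] primitive_power_limit[OF prim P, of "b 0" i]
    by simp_all
  obtain i where i: "w $ i \<noteq> 0" using w(1) by (auto simp: vec_eq_iff)
  have "Complex (a n $ i / r ^ n) (b n $ i / r ^ n) / w $ i = (z / of_real r) ^ n" for n
  proof -
    have "Complex (a n $ i / r ^ n) (b n $ i / r ^ n) = z ^ n * w $ i / of_real (r ^ n)"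
      by (simp only: complex_eq_iff a_def b_def vec_lambda_beta complex.sel Re_divide_of_real Im_divide_of_real)
    then show ?thesis using i by (simp add: power_divide)
  qed
  moreover have "(\<lambda>n. Complex (a n $ i / r ^ n) (b n $ i / r ^ n) / w $ i)
      \<longlonglongrightarrow> Complex ((u \<bullet> a 0) / (u \<bullet> v) * v $ i) ((u \<bullet> b 0) / (u \<bullet> v) * v $ i) / w $ i"
    using i by (intro tendsto_divide tendsto_Complex lim tendsto_const)
  ultimately have "z / of_real r = 1 \<or> cmod (z / of_real r) < 1"
    by (intro complex_power_convergent_imp) simp
  then show ?thesis using D(2) z(2) by (auto simp: norm_divide)
qed

lemma pf_eigenvalue_eq:
  assumes prim: "primitive T" and P: "perron T r u v"
  shows "pf_eigenvalue T = r"
  unfolding pf_eigenvalue_def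
proof (rule the_equality)
  note D = perronD[OF P]
  have "v \<noteq> 0" using D(4) by (metis less_irrefl zero_index)
  then have r: "ceigenvalue T (of_real r)" using D(5) by (rule ceigenvalue_of_real[rotated])
  then show "ceigenvalue T (of_real r) \<and>
      (\<forall>z. ceigenvalue T z \<and> z \<noteq> of_real r \<longrightarrow> cmod z < cmod (of_real r))"
    using perron_dominant[OF prim P] D(2) by auto
  fix q assume q: "ceigenvalue T (of_real q) \<and>
      (\<forall>z. ceigenvalue T z \<and> z \<noteq> of_real q \<longrightarrow> cmod z < cmod (of_real q))"
  show "q = r"
  proof (rule ccontr)
    assume "q \<noteq> r"
    then have "complex_of_real q \<noteq> of_real r" by simp
    then have "cmod (of_real r) < cmod (of_real q)" using q r by metis
    moreover have "cmod (of_real q) < r"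
      using perron_dominant[OF prim P, of "of_real q"] q \<open>complex_of_real q \<noteq> of_real r\<close> by blast
    ultimately show False by simp
  qed
qed

text \<open>The rescaled orbit of an eigenvector is constant, hence equal to its limit, which lies
  on the line through \<open>v\<close>. This simplicity of \<open>r\<close> is what makes the
  bordered matrix invertible.\<close>

lemma perron_eigenspace:
  assumes prim: "primitive T" and P: "perron T r u v" and x: "T *v x = r *\<^sub>R x"
  shows "x = ((u \<bullet> x) / (u \<bullet> v)) *\<^sub>R v"
proof (rule vec_eq_iff[THEN iffD2], rule allI)
  fix i
  have "(\<lambda>n. (mpow T n *v x) $ i / r ^ n) = (\<lambda>n. x $ i)"
    using perronD(2)[OF P] by (simp add: mpow_eigenvector[OF x])
  then show "x $ i = (((u \<bullet> x) / (u \<bullet> v)) *\<^sub>R v) $ i"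
    using primitive_power_limit[OF prim P, of x i] by (simp add: LIMSEQ_const_iff)
qed

text \<open>Testing \<open>S v\<close> against the left eigenvector \<open>u'\<close> of the other
  matrix turns both sides into multiples of \<open>u' \<bullet> v > 0\<close>. This is the source of
  the continuity of the eigenvalue in \<open>t\<close>.\<close>

lemma perron_comparison:
  assumes S: "perron S r u v" and T: "perron T r' u' v'"
    and le: "\<And>i j. S $ i $ j \<le> c * T $ i $ j"
  shows "r \<le> c * r'"
proof -
  note D = perronD[OF S] and E = perronD[OF T]
  have "r * (u' \<bullet> v) = u' \<bullet> (S *v v)" using D by simp
  also have "\<dots> \<le> u' \<bullet> (c *\<^sub>R (T *v v))"
    unfolding inner_vec_sum
  proof (intro sum_mono mult_left_mono)
    fix i
    have "(S *v v) $ i \<le> (\<Sum>j\<in>UNIV. (c * T $ i $ j) * v $ j)"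
      unfolding matrix_vector_mult_def using le D(4)
      by (auto intro!: sum_mono mult_right_mono simp: less_imp_le)
    then show "(S *v v) $ i \<le> (c *\<^sub>R (T *v v)) $ i"
      by (simp add: matrix_vector_mult_def sum_distrib_left mult_ac)
  qed (use E(3) in \<open>simp add: less_imp_le\<close>)
  also have "\<dots> = c * r' * (u' \<bullet> v)"
    using inner_mpow_eigenvector[OF E(6), of 1 v] by simp
  finally show ?thesis
    using inner_pos_vec[OF E(3) D(4)] by simp
qed

section \<open>Smoothness of the Perron--Frobenius eigenvalue\<close>

lemma differentiable_prod:
  fixes f :: "'a \<Rightarrow> 'b::real_normed_vector \<Rightarrow> real"
  assumes "finite I" "\<And>i. i \<in> I \<Longrightarrow> f i differentiable (at x)"
  shows "(\<lambda>t. \<Prod>i\<in>I. f i t) differentiable (at x)"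
  using assms by (induction I rule: finite_induct) (auto intro!: differentiable_mult)

lemma det_differentiable:
  fixes F :: "'b::real_normed_vector \<Rightarrow> real ^ 'm ^ 'm"
  assumes "\<And>i j. (\<lambda>t. F t $ i $ j) differentiable (at x)"
  shows "(\<lambda>t. det (F t)) differentiable (at x)"
  unfolding det_def
  by (intro differentiable_sum differentiable_mult differentiable_const differentiable_prod ballI assms)
    (auto simp: finite_permutations)

lemma det_isCont:
  fixes F :: "'b::real_normed_vector \<Rightarrow> real ^ 'm ^ 'm"
  assumes "\<And>i j. isCont (\<lambda>t. F t $ i $ j) x"
  shows "isCont (\<lambda>t. det (F t)) x"
  unfolding det_def isCont_def using assms
  by (intro tendsto_sum tendsto_mult tendsto_const tendsto_prod) (auto simp: isCont_def)

text \<open>Adding the all-ones matrix makes \<open>r I - T\<close> invertible, and normalised eigenvectors solve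
  the resulting linear system, so Cramer's rule transfers the regularity of the eigenvalue to
  the eigenvectors.\<close>

definition bordered :: "real \<Rightarrow> real ^ 'm ^ 'm \<Rightarrow> real ^ 'm ^ 'm" where
  "bordered r T = (\<chi> i j. (if i = j then r else 0) - T $ i $ j + 1)"

lemma bordered_mult: "(bordered r T *v w) $ i = r * w $ i - (T *v w) $ i + (\<Sum>j\<in>UNIV. w $ j)"
proof -
  have "(\<Sum>j\<in>UNIV. ((if i = j then r else 0) - T $ i $ j + 1) * w $ j) =
    (\<Sum>j\<in>UNIV. (if i = j then r * w $ j else 0)) - (\<Sum>j\<in>UNIV. T $ i $ j * w $ j) + (\<Sum>j\<in>UNIV. w $ j)"
    unfolding sum_subtractf[symmetric] sum.distrib[symmetric]
    by (rule sum.cong) (auto simp: algebra_simps)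
  then show ?thesis
    by (simp add: bordered_def matrix_vector_mult_def)
qed

text \<open>A kernel vector \<open>w\<close> satisfies \<open>T w = r w + s 1\<close> with
  \<open>s\<close> the sum of its entries. Pairing with \<open>u\<close> forces
  \<open>s = 0\<close>, so \<open>w\<close> is a multiple of \<open>v\<close>, and its zero sum
  makes the multiple 0.\<close>

lemma perron_bordered:
  assumes prim: "primitive T" and P: "perron T r u v"
  shows "bordered r T *v v = 1" "det (bordered r T) \<noteq> 0"
proof -
  note D = perronD[OF P]
  show "bordered r T *v v = 1"
    by (simp add: vec_eq_iff bordered_mult D)
  have "w = 0" if w: "bordered r T *v w = 0" for w
  proof -
    define s where "s = (\<Sum>j\<in>UNIV. w $ j)"
    have *: "(T *v w) $ i = r * w $ i + s" for i
      using arg_cong[OF w, of "\<lambda>x. x $ i"] by (simp add: bordered_mult s_def)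
    have "u \<bullet> (T *v w) = r * (u \<bullet> w) + s * (\<Sum>i\<in>UNIV. u $ i)"
      unfolding inner_vec_sum * by (simp add: algebra_simps sum.distrib sum_distrib_left)
    moreover have "u \<bullet> (T *v w) = r * (u \<bullet> w)"
      using inner_mpow_eigenvector[OF D(6), of 1 w] by simp
    ultimately have s: "s = 0" by (simp add: D)
    then have "T *v w = r *\<^sub>R w" using * by (simp add: vec_eq_iff)
    then have w: "w = ((u \<bullet> w) / (u \<bullet> v)) *\<^sub>R v" by (rule perron_eigenspace[OF prim P])
    have "s = (u \<bullet> w) / (u \<bullet> v) * (\<Sum>j\<in>UNIV. v $ j)"
      unfolding s_def by (subst w) (simp add: sum_distrib_left)
    then have "(u \<bullet> w) / (u \<bullet> v) = 0" using s D(8) by simp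
    then show "w = 0" using w by (metis scaleR_zero_left)
  qed
  then show "det (bordered r T) \<noteq> 0"
    by (metis invertible_det_nz invertible_left_inverse matrix_left_invertible_ker)
qed

lemma perron_cramer:
  assumes "primitive T" "perron T r u v"
  shows "v $ k = det (\<chi> i j. if j = k then 1 else bordered r T $ i $ j) / det (bordered r T)"
  using cramer[OF perron_bordered(2)[OF assms], of v 1] perron_bordered(1)[OF assms]
  by (simp add: vec_eq_iff cong: if_cong)

lemma perron_vector_isCont:
  fixes F :: "'b::real_normed_vector \<Rightarrow> real ^ 'm ^ 'm"
  assumes P: "\<And>t. primitive (F t)" "\<And>t. perron (F t) (r t) (u t) (v t)"
    and F: "\<And>i j. isCont (\<lambda>t. F t $ i $ j) x" and r: "isCont r x"
  shows "isCont (\<lambda>t. v t $ k) x"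
  unfolding perron_cramer[OF P]
proof (intro continuous_divide det_isCont)
  have b: "isCont (\<lambda>t. bordered (r t) (F t) $ i $ j) x" for i j
    using F r by (cases "i = j") (simp_all add: bordered_def)
  then show "isCont (\<lambda>t. bordered (r t) (F t) $ i $ j) x" for i j .
  show "isCont (\<lambda>t. (\<chi> i j. if j = k then 1 else bordered (r t) (F t) $ i $ j) $ i $ j) x" for i j
    using b by (cases "j = k") simp_all
qed (use perron_bordered(2)[OF P] in auto)

lemma perron_vector_differentiable:
  fixes F :: "'b::real_normed_vector \<Rightarrow> real ^ 'm ^ 'm"
  assumes P: "\<And>t. primitive (F t)" "\<And>t. perron (F t) (r t) (u t) (v t)"
    and F: "\<And>i j. (\<lambda>t. F t $ i $ j) differentiable (at x)" and r: "r differentiable (at x)"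
  shows "(\<lambda>t. v t $ k) differentiable (at x)"
  unfolding perron_cramer[OF P]
proof (intro differentiable_divide det_differentiable)
  have b: "(\<lambda>t. bordered (r t) (F t) $ i $ j) differentiable (at x)" for i j
    using F r by (cases "i = j") (simp_all add: bordered_def)
  then show "(\<lambda>t. bordered (r t) (F t) $ i $ j) differentiable (at x)" for i j .
  show "(\<lambda>t. (\<chi> i j. if j = k then 1 else bordered (r t) (F t) $ i $ j) $ i $ j) differentiable (at x)" for i j
    using b by (cases "j = k") simp_all
qed (use perron_bordered(2)[OF P] in auto)

text \<open>As \<open>f\<close> vanishes at \<open>x\<close>, the increment of \<open>g\<close> is
  multiplied by something of the order of \<open>norm (y - x)\<close>, so continuity of
  \<open>g\<close> suffices. This avoids the circle of differentiating the eigenvectors before the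
  eigenvalue.\<close>

lemma has_derivative_vanishing_mult:
  fixes f g :: "'a::real_normed_vector \<Rightarrow> real"
  assumes f: "(f has_derivative f') (at x)" "f x = 0" and g: "isCont g x"
  shows "((\<lambda>t. f t * g t) has_derivative (\<lambda>h. f' h * g x)) (at x)"
  unfolding has_derivative_iff_norm
proof
  from f have bl: "bounded_linear f'" and
    lim: "((\<lambda>y. norm ((f y - f x) - f' (y - x)) / norm (y - x)) \<longlongrightarrow> 0) (at x)"
    unfolding has_derivative_iff_norm by auto
  show "bounded_linear (\<lambda>h. f' h * g x)"
    using bl by (rule bounded_linear_mult_const)
  obtain K where K: "\<And>h. norm (f' h) \<le> norm h * K"
    using bounded_linear.bounded[OF bl] by blast
  have gl: "(g \<longlongrightarrow> g x) (at x)" using g by (simp add: isCont_def)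
  have "((\<lambda>y. norm ((f y - f x) - f' (y - x)) / norm (y - x) * \<bar>g y\<bar> + K * \<bar>g y - g x\<bar>)
      \<longlongrightarrow> 0 * \<bar>g x\<bar> + K * \<bar>g x - g x\<bar>) (at x)"
    by (intro tendsto_intros lim gl)
  then have lim0: "((\<lambda>y. norm ((f y - f x) - f' (y - x)) / norm (y - x) * \<bar>g y\<bar> + K * \<bar>g y - g x\<bar>)
      \<longlongrightarrow> 0) (at x)"
    by simp
  have ev: "\<forall>\<^sub>F y in at x. norm (norm (f y * g y - f x * g x - f' (y - x) * g x) / norm (y - x))
      \<le> norm ((f y - f x) - f' (y - x)) / norm (y - x) * \<bar>g y\<bar> + K * \<bar>g y - g x\<bar>"
    unfolding eventually_at_filter
  proof (intro always_eventually allI impI)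
    fix y assume y: "y \<noteq> x"
    have "f y * g y - f x * g x - f' (y - x) * g x = (f y - f x - f' (y - x)) * g y + f' (y - x) * (g y - g x)"
      using f(2) by (simp add: algebra_simps)
    also have "\<bar>\<dots>\<bar> \<le> \<bar>f y - f x - f' (y - x)\<bar> * \<bar>g y\<bar> + \<bar>f' (y - x)\<bar> * \<bar>g y - g x\<bar>"
      by (metis abs_mult abs_triangle_ineq)
    also have "\<dots> \<le> \<bar>f y - f x - f' (y - x)\<bar> * \<bar>g y\<bar> + (norm (y - x) * K) * \<bar>g y - g x\<bar>"
      using K[of "y - x"] by (intro add_left_mono mult_right_mono) auto
    finally show "norm (norm (f y * g y - f x * g x - f' (y - x) * g x) / norm (y - x))
      \<le> norm ((f y - f x) - f' (y - x)) / norm (y - x) * \<bar>g y\<bar> + K * \<bar>g y - g x\<bar>"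
      using y by (simp add: field_simps)
  qed
  show "((\<lambda>y. norm (f y * g y - f x * g x - f' (y - x) * g x) / norm (y - x)) \<longlongrightarrow> 0) (at x)"
    by (rule Lim_null_comparison[OF ev lim0])
qed

section \<open>The tilted matrices and the regularity of their eigenvalue\<close>

lemma tilted_mat_nth: "tilted_mat A B t $ p $ q = (\<Sum>i\<in>UNIV. exp (t $ i) * A i $ p $ q) + B $ p $ q"
  by (simp add: tilted_mat_def sum_component)

lemma tilted_mat_0: "tilted_mat A B 0 = total_mat A B"
  by (simp add: tilted_mat_def total_mat_def)

lemma tilted_mat_mult:
  fixes A :: "'l :: finite \<Rightarrow> real ^ 'm ^ 'm"
  shows "tilted_mat A B t *v x = (\<Sum>i\<in>UNIV. exp (t $ i) *\<^sub>R (A i *v x)) + B *v x"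
  unfolding tilted_mat_def matrix_vector_mult_add_rdistrib
  by (simp add: vec_eq_iff matrix_vector_mult_def sum_component sum_distrib_right sum_distrib_left
      sum.swap[of _ "UNIV :: 'm set"] mult_ac)

lemma tilted_mat_nonneg:
  "(\<And>i p q. 0 \<le> A i $ p $ q) \<Longrightarrow> (\<And>p q. 0 \<le> B $ p $ q) \<Longrightarrow> 0 \<le> tilted_mat A B t $ p $ q"
  by (auto simp: tilted_mat_nth intro!: add_nonneg_nonneg sum_nonneg)

lemma tilted_mat_le:
  assumes "\<And>i p q. 0 \<le> A i $ p $ q" "\<And>p q. 0 \<le> B $ p $ q"
  shows "tilted_mat A B t $ p $ q \<le> exp (norm (t - s)) * tilted_mat A B s $ p $ q"
proof -
  have "exp (t $ i) * A i $ p $ q \<le> exp (norm (t - s)) * (exp (s $ i) * A i $ p $ q)" for i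
  proof -
    have "t $ i \<le> norm (t - s) + s $ i"
      using component_le_norm_cart[of "t - s" i] by simp
    then have "exp (t $ i) \<le> exp (norm (t - s)) * exp (s $ i)" by (simp add: exp_add[symmetric])
    then show ?thesis using assms(1)[of i p q] by (simp add: mult.assoc[symmetric] mult_right_mono)
  qed
  moreover have "B $ p $ q \<le> exp (norm (t - s)) * B $ p $ q"
    using assms(2)[of p q] by (simp add: mult_le_cancel_right1)
  ultimately show ?thesis
    by (auto simp: tilted_mat_nth distrib_left sum_distrib_left intro!: add_mono sum_mono)
qed

lemma tilted_mat_primitive:
  assumes nn: "\<And>i p q. 0 \<le> A i $ p $ q" "\<And>p q. 0 \<le> B $ p $ q" and prim: "primitive (total_mat A B)"
  shows "primitive (tilted_mat A B t)"
proof -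
  obtain k where k: "k \<ge> 1" "\<And>i j. 0 < mpow (total_mat A B) k $ i $ j"
    using prim by (auto simp: primitive_def)
  have "0 < mpow (tilted_mat A B t) k $ i $ j" for i j
  proof -
    have "mpow (tilted_mat A B 0) k $ i $ j \<le> exp (norm (0 - t)) ^ k * mpow (tilted_mat A B t) k $ i $ j"
      using mpow_mono[OF tilted_mat_nonneg[of A B 0] tilted_mat_le[of A B 0 _ _ t]] nn by simp
    then have "0 < exp (norm (0 - t)) ^ k * mpow (tilted_mat A B t) k $ i $ j"
      using k(2)[of i j] unfolding tilted_mat_0 by linarith
    then show ?thesis by (simp add: zero_less_mult_iff)
  qed
  moreover have "0 \<le> tilted_mat A B t $ i $ j" for i j
    using nn by (rule tilted_mat_nonneg)
  ultimately show ?thesis unfolding primitive_def using k(1) by blast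
qed

text \<open>Comparison in both directions shows that \<open>ln r\<close> is Lipschitz with constant
  1, which squeezes \<open>r t\<close> between multiples of \<open>r s\<close>.\<close>

lemma tilted_perron_isCont:
  assumes nn: "\<And>i p q. 0 \<le> A i $ p $ q" "\<And>p q. 0 \<le> B $ p $ q"
    and P: "\<And>t. perron (tilted_mat A B t) (r t) (u t) (v t)"
  shows "isCont r s"
  unfolding isCont_def
proof (rule tendsto_sandwich)
  have "r t \<le> exp (norm (t - s)) * r s" for t s
    using tilted_mat_le[OF nn] by (intro perron_comparison[OF P P])
  note le = this
  show "\<forall>\<^sub>F t in at s. r t \<le> exp (norm (t - s)) * r s" by (simp add: le)
  have "exp (- norm (t - s)) * r s \<le> r t" for t
    using le[of s t] by (simp add: exp_minus field_simps norm_minus_commute)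
  then show "\<forall>\<^sub>F t in at s. exp (- norm (t - s)) * r s \<le> r t" by simp
  have *: "((\<lambda>t. norm (t - s)) \<longlongrightarrow> norm (s - s)) (at s)" by (intro tendsto_intros)
  show "((\<lambda>t. exp (norm (t - s)) * r s) \<longlongrightarrow> r s) (at s)"
    using tendsto_mult[OF tendsto_exp[OF *] tendsto_const, of "r s"] by simp
  show "((\<lambda>t. exp (- norm (t - s)) * r s) \<longlongrightarrow> r s) (at s)"
    using tendsto_mult[OF tendsto_exp[OF tendsto_minus[OF *]] tendsto_const, of "r s"] by simp
qed

text \<open>Pairing with the left eigenvector frozen at \<open>s\<close> gives the exact identity
  \<open>(r t - r s) (u s \<bullet> v t) = u s \<bullet> ((M(t) - M(s)) v t)\<close>. Each summand
  on the right, divided by \<open>u s \<bullet> v t\<close>, is a factor vanishing at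
  \<open>s\<close> times a continuous quotient, so no derivative of \<open>v\<close> enters.\<close>

lemma tilted_perron_has_derivative:
  fixes A :: "'l :: finite \<Rightarrow> real ^ 'm ^ 'm"
  assumes nn: "\<And>i p q. 0 \<le> A i $ p $ q" "\<And>p q. 0 \<le> B $ p $ q"
    and prim: "primitive (total_mat A B)"
    and P: "\<And>t. perron (tilted_mat A B t) (r t) (u t) (v t)"
  shows "(r has_derivative (\<lambda>h. \<Sum>i\<in>UNIV. (exp (s $ i) * (u s \<bullet> (A i *v v s)) / (u s \<bullet> v s)) * h $ i)) (at s)"
proof -
  note D = perronD[OF P]
  have prim': "primitive (tilted_mat A B t)" for t
    using nn prim by (rule tilted_mat_primitive)
  have r: "isCont r t" for t using nn P by (rule tilted_perron_isCont)
  have v: "isCont (\<lambda>t. v t $ k) s" for k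
    by (rule perron_vector_isCont[OF prim' P _ r]) (auto simp: tilted_mat_nth intro!: continuous_intros)
  define g where "g i t = (u s \<bullet> (A i *v v t)) / (u s \<bullet> v t)" for i t
  have pos: "u s \<bullet> v t > 0" for t using D by (intro inner_pos_vec) auto
  have g: "isCont (g i) s" for i
    unfolding g_def isCont_def inner_vec_sum matrix_vector_mult_def vec_lambda_beta
    using v pos[of s]
    by (intro tendsto_divide tendsto_sum tendsto_mult tendsto_const) (auto simp: isCont_def inner_vec_sum)
  have diff: "r t = r s + (\<Sum>i\<in>UNIV. (exp (t $ i) - exp (s $ i)) * g i t)" for t
  proof -
    have "r t * (u s \<bullet> v t) - r s * (u s \<bullet> v t) = u s \<bullet> (tilted_mat A B t *v v t) - u s \<bullet> (tilted_mat A B s *v v t)"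
      using inner_mpow_eigenvector[OF D(6), of s 1 "v t"] D(5)[of t] by simp
    also have "\<dots> = (\<Sum>i\<in>UNIV. (exp (t $ i) - exp (s $ i)) * (u s \<bullet> (A i *v v t)))"
      unfolding tilted_mat_mult by (simp add: inner_add_right inner_sum_right sum_subtractf left_diff_distrib)
    also have "\<dots> = (\<Sum>i\<in>UNIV. (exp (t $ i) - exp (s $ i)) * g i t) * (u s \<bullet> v t)"
      using pos[of t] by (simp add: g_def sum_distrib_right)
    finally have "(r t - r s) * (u s \<bullet> v t) = (\<Sum>i\<in>UNIV. (exp (t $ i) - exp (s $ i)) * g i t) * (u s \<bullet> v t)"
      by (simp add: left_diff_distrib)
    then show ?thesis using pos[of t] by simp
  qed
  have "((\<lambda>t. (exp (t $ i) - exp (s $ i)) * g i t) has_derivative (\<lambda>h. exp (s $ i) * h $ i * g i s)) (at s)" for i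
  proof (rule has_derivative_vanishing_mult)
    have "((\<lambda>t. t $ i) has_derivative (\<lambda>h. h $ i)) (at s)"
      by (rule bounded_linear_imp_has_derivative) (rule bounded_linear_vec_nth)
    then show "((\<lambda>t. exp (t $ i) - exp (s $ i)) has_derivative (\<lambda>h. exp (s $ i) * h $ i)) (at s)"
      by (auto intro!: derivative_eq_intros)
  qed (use g in auto)
  then have "((\<lambda>t. r s + (\<Sum>i\<in>UNIV. (exp (t $ i) - exp (s $ i)) * g i t)) has_derivative
      (\<lambda>h. 0 + (\<Sum>i\<in>UNIV. exp (s $ i) * h $ i * g i s))) (at s)"
    by (intro has_derivative_add has_derivative_const has_derivative_sum)
  then show ?thesis
    unfolding diff[symmetric] by (simp add: g_def mult_ac)
qed

section \<open>Second-order expansion and symmetry of the second derivative\<close>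

lemma second_order_expansion:
  fixes f :: "'a::euclidean_space \<Rightarrow> real" and g :: "'a \<Rightarrow> 'a"
  assumes f: "\<And>x. (f has_derivative (\<lambda>h. g x \<bullet> h)) (at x)"
    and g: "(g has_derivative g') (at 0)"
  shows "((\<lambda>s. (f (s *\<^sub>R a) - f 0 - s * (g 0 \<bullet> a)) / s\<^sup>2) \<longlongrightarrow> (g' a \<bullet> a) / 2) (at_right 0)"
proof (rule tendstoI)
  fix e :: real assume e: "e > 0"
  \<comment> \<open>The final error is \<open>e' * (norm a * norm a)\<close>; the added 1 covers
    \<open>a = 0\<close>.\<close>
  define e' where "e' = e / (2 * (norm a * norm a + 1))"
  have e': "e' > 0" using e by (simp add: e'_def add_nonneg_pos)
  have e'': "e' * (norm a * norm a) < e"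
  proof -
    have "e' * (norm a * norm a) \<le> e' * (norm a * norm a + 1)" using e' by simp
    also have "\<dots> = e / 2" by (simp add: e'_def field_simps add_nonneg_eq_0_iff)
    finally show ?thesis using e by simp
  qed
  interpret g': bounded_linear g' using g by (rule has_derivative_bounded_linear)
  obtain d where d: "d > 0" "\<And>x. norm x < d \<Longrightarrow> norm (g x - g 0 - g' x) \<le> e' * norm x"
    using g e' unfolding has_derivative_at_alt by (metis diff_zero)
  have "\<bar>(f (s *\<^sub>R a) - f 0 - s * (g 0 \<bullet> a)) / s\<^sup>2 - (g' a \<bullet> a) / 2\<bar> < e"
    if s: "0 < s" "s * norm a < d" for s
  proof -
    \<comment> \<open>\<open>g\<close> is assumed differentiable at 0 only, so the mean value
      theorem is applied to \<open>f\<close> minus the expected linear and quadratic terms; the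
      derivative of this difference along the ray is the error of the linear approximation of
      \<open>g\<close> at 0.\<close>
    define h where "h x = f (x *\<^sub>R a) - x * (g 0 \<bullet> a) - x\<^sup>2 / 2 * (g' a \<bullet> a)" for x
    have h': "(h has_derivative (\<lambda>y. (g (x *\<^sub>R a) \<bullet> a - g 0 \<bullet> a - x * (g' a \<bullet> a)) * y)) (at x)" for x
    proof -
      have "((\<lambda>x. f (x *\<^sub>R a)) has_derivative (\<lambda>y. g (x *\<^sub>R a) \<bullet> (y *\<^sub>R a))) (at x)"
        by (rule has_derivative_compose[OF _ f]) (auto intro!: derivative_eq_intros)
      then show ?thesis
        unfolding h_def by (auto intro!: derivative_eq_intros simp: algebra_simps)
    qed
    obtain z where z: "0 < z" "z < s"
      "h s - h 0 = (g (z *\<^sub>R a) \<bullet> a - g 0 \<bullet> a - z * (g' a \<bullet> a)) * (s - 0)"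
    proof (rule mvt[of 0 s h])
      show "continuous_on {0..s} h"
        using h' by (intro continuous_at_imp_continuous_on ballI has_derivative_continuous)
    qed (use h' s in auto)
    have "z * norm a < d" using z s by (meson le_less_trans less_imp_le mult_right_mono norm_ge_zero)
    then have "norm (g (z *\<^sub>R a) - g 0 - g' (z *\<^sub>R a)) \<le> e' * (z * norm a)"
      using d(2)[of "z *\<^sub>R a"] z by simp
    then have "\<bar>(g (z *\<^sub>R a) - g 0 - g' (z *\<^sub>R a)) \<bullet> a\<bar> \<le> e' * (z * norm a) * norm a"
      by (intro order_trans[OF Cauchy_Schwarz_ineq2] mult_right_mono) auto
    moreover have "(g (z *\<^sub>R a) - g 0 - g' (z *\<^sub>R a)) \<bullet> a = g (z *\<^sub>R a) \<bullet> a - g 0 \<bullet> a - z * (g' a \<bullet> a)"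
      by (simp add: inner_diff_left g'.scaleR)
    ultimately have "\<bar>h s - h 0\<bar> \<le> e' * (z * norm a) * norm a * s"
      unfolding z(3) using s by (simp add: abs_mult mult_right_mono)
    also have "\<dots> \<le> e' * (s * norm a) * norm a * s"
      using z s e' by (intro mult_right_mono mult_left_mono) auto
    finally have "\<bar>h s - h 0\<bar> / s\<^sup>2 \<le> e' * (norm a * norm a)"
      using s by (simp add: field_simps power2_eq_square)
    moreover have "(f (s *\<^sub>R a) - f 0 - s * (g 0 \<bullet> a)) / s\<^sup>2 - (g' a \<bullet> a) / 2 = (h s - h 0) / s\<^sup>2"
      using s by (simp add: h_def field_simps)
    ultimately show ?thesis using e'' by (simp add: abs_divide)
  qed
  moreover have "((\<lambda>s. s * norm a) \<longlongrightarrow> 0 * norm a) (at_right 0)"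
    by (intro tendsto_intros)
  then have "\<forall>\<^sub>F s in at_right 0. s * norm a < d"
    using d(1) by (intro order_tendstoD(2)) auto
  ultimately show "\<forall>\<^sub>F s in at_right 0. dist ((f (s *\<^sub>R a) - f 0 - s * (g 0 \<bullet> a)) / s\<^sup>2) ((g' a \<bullet> a) / 2) < e"
    using eventually_at_right_less[of 0]
    by (auto simp: dist_real_def elim: eventually_elim2)
qed

text \<open>The mean value theorem in the direction \<open>b\<close> turns the second difference
  into a first difference of \<open>g\<close> at two points whose distance from 0 is of order
  \<open>s\<close>, where the linear approximation of \<open>g\<close> applies.\<close>

lemma second_difference_limit:
  fixes f :: "'a::euclidean_space \<Rightarrow> real" and g :: "'a \<Rightarrow> 'a"
  assumes f: "\<And>x. (f has_derivative (\<lambda>h. g x \<bullet> h)) (at x)"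
    and g: "(g has_derivative g') (at 0)"
  shows "((\<lambda>s. (f (s *\<^sub>R a + s *\<^sub>R b) - f (s *\<^sub>R a) - f (s *\<^sub>R b) + f 0) / s\<^sup>2) \<longlongrightarrow> g' a \<bullet> b) (at_right 0)"
proof (rule tendstoI)
  fix e :: real assume e: "e > 0"
  \<comment> \<open>The two points have norms at most \<open>s * (norm a + norm b)\<close> and
    \<open>s * norm b\<close>; the inner product with \<open>b\<close> contributes the last
    factor.\<close>
  define M where "M = (norm a + 2 * norm b) * norm b"
  define e' where "e' = e / (2 * (M + 1))"
  have M: "M \<ge> 0" by (simp add: M_def)
  have e': "e' > 0" using e M by (simp add: e'_def add_nonneg_pos)
  have e'': "e' * M < e"
  proof -
    have "e' * M \<le> e' * (M + 1)" using e' by simp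
    also have "\<dots> = e / 2" using M by (simp add: e'_def field_simps)
    finally show ?thesis using e by simp
  qed
  interpret g': bounded_linear g' using g by (rule has_derivative_bounded_linear)
  obtain d where d: "d > 0" "\<And>x. norm x < d \<Longrightarrow> norm (g x - g 0 - g' x) \<le> e' * norm x"
    using g e' unfolding has_derivative_at_alt by (metis diff_zero)
  have "\<bar>(f (s *\<^sub>R a + s *\<^sub>R b) - f (s *\<^sub>R a) - f (s *\<^sub>R b) + f 0) / s\<^sup>2 - g' a \<bullet> b\<bar> < e"
    if s: "0 < s" "s * (norm a + norm b) < d" for s
  proof -
    define h where "h x = f (s *\<^sub>R a + x *\<^sub>R b) - f (x *\<^sub>R b) - x * s * (g' a \<bullet> b)" for x
    have h': "(h has_derivative (\<lambda>y. (g (s *\<^sub>R a + x *\<^sub>R b) \<bullet> b - g (x *\<^sub>R b) \<bullet> b - s * (g' a \<bullet> b)) * y)) (at x)" for x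
    proof -
      have "((\<lambda>x. f (s *\<^sub>R a + x *\<^sub>R b)) has_derivative (\<lambda>y. g (s *\<^sub>R a + x *\<^sub>R b) \<bullet> (y *\<^sub>R b))) (at x)"
        by (rule has_derivative_compose[OF _ f]) (auto intro!: derivative_eq_intros)
      moreover have "((\<lambda>x. f (x *\<^sub>R b)) has_derivative (\<lambda>y. g (x *\<^sub>R b) \<bullet> (y *\<^sub>R b))) (at x)"
        by (rule has_derivative_compose[OF _ f]) (auto intro!: derivative_eq_intros)
      ultimately show ?thesis
        unfolding h_def by (auto intro!: derivative_eq_intros simp: algebra_simps)
    qed
    obtain z where z: "0 < z" "z < s"
      "h s - h 0 = (g (s *\<^sub>R a + z *\<^sub>R b) \<bullet> b - g (z *\<^sub>R b) \<bullet> b - s * (g' a \<bullet> b)) * (s - 0)"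
    proof (rule mvt[of 0 s h])
      show "continuous_on {0..s} h"
        using h' by (intro continuous_at_imp_continuous_on ballI has_derivative_continuous)
    qed (use h' s in auto)
    let ?R = "\<lambda>x. g x - g 0 - g' x"
    have zb: "z * norm b \<le> s * norm b" using z by (simp add: mult_right_mono)
    have n1: "norm (s *\<^sub>R a + z *\<^sub>R b) \<le> s * (norm a + norm b)"
      using norm_triangle_ineq[of "s *\<^sub>R a" "z *\<^sub>R b"] zb s z by (simp add: distrib_left)
    have n2: "norm (z *\<^sub>R b) \<le> s * norm b" using zb z by simp
    have "s * norm b \<le> s * (norm a + norm b)" using s by simp
    then have "norm (z *\<^sub>R b) < d" using n2 s by linarith
    then have "norm (?R (z *\<^sub>R b)) \<le> e' * (s * norm b)"
      using d(2)[of "z *\<^sub>R b"] n2 e' by (meson mult_left_mono order_trans less_imp_le)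
    moreover have "norm (?R (s *\<^sub>R a + z *\<^sub>R b)) \<le> e' * (s * (norm a + norm b))"
      using d(2)[of "s *\<^sub>R a + z *\<^sub>R b"] n1 e' s by (meson le_less_trans mult_left_mono order_trans less_imp_le)
    ultimately have "norm (?R (s *\<^sub>R a + z *\<^sub>R b) - ?R (z *\<^sub>R b)) \<le> e' * (s * (norm a + norm b)) + e' * (s * norm b)"
      using norm_triangle_ineq4[of "?R (s *\<^sub>R a + z *\<^sub>R b)" "?R (z *\<^sub>R b)"] by linarith
    also have "\<dots> = e' * s * (norm a + 2 * norm b)" by (simp add: algebra_simps)
    finally have "\<bar>(?R (s *\<^sub>R a + z *\<^sub>R b) - ?R (z *\<^sub>R b)) \<bullet> b\<bar> \<le> e' * s * (norm a + 2 * norm b) * norm b"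
      by (intro order_trans[OF Cauchy_Schwarz_ineq2] mult_right_mono) auto
    moreover have "(?R (s *\<^sub>R a + z *\<^sub>R b) - ?R (z *\<^sub>R b)) \<bullet> b = g (s *\<^sub>R a + z *\<^sub>R b) \<bullet> b - g (z *\<^sub>R b) \<bullet> b - s * (g' a \<bullet> b)"
      by (simp add: inner_diff_left g'.scaleR g'.add inner_add_left)
    ultimately have "\<bar>h s - h 0\<bar> \<le> e' * s * (norm a + 2 * norm b) * norm b * s"
      unfolding z(3) using s by (simp add: abs_mult mult_right_mono)
    then have "\<bar>h s - h 0\<bar> / s\<^sup>2 \<le> e' * M"
      using s by (simp add: M_def field_simps power2_eq_square)
    moreover have "(f (s *\<^sub>R a + s *\<^sub>R b) - f (s *\<^sub>R a) - f (s *\<^sub>R b) + f 0) / s\<^sup>2 - g' a \<bullet> b = (h s - h 0) / s\<^sup>2"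
      using s by (simp add: h_def field_simps power2_eq_square)
    ultimately show ?thesis using e'' by (simp add: abs_divide)
  qed
  moreover have "((\<lambda>s. s * (norm a + norm b)) \<longlongrightarrow> 0 * (norm a + norm b)) (at_right 0)"
    by (intro tendsto_intros)
  then have "\<forall>\<^sub>F s in at_right 0. s * (norm a + norm b) < d"
    using d(1) by (intro order_tendstoD(2)) auto
  ultimately show "\<forall>\<^sub>F s in at_right 0.
      dist ((f (s *\<^sub>R a + s *\<^sub>R b) - f (s *\<^sub>R a) - f (s *\<^sub>R b) + f 0) / s\<^sup>2) (g' a \<bullet> b) < e"
    using eventually_at_right_less[of 0]
    by (auto simp: dist_real_def elim: eventually_elim2)
qed

text \<open>The second difference quotient does not change when \<open>a\<close> and
  \<open>b\<close> are exchanged, so uniqueness of its limit gives Schwarz's theorem without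
  continuous second derivatives.\<close>

lemma second_derivative_symmetric:
  fixes f :: "'a::euclidean_space \<Rightarrow> real" and g :: "'a \<Rightarrow> 'a"
  assumes "\<And>x. (f has_derivative (\<lambda>h. g x \<bullet> h)) (at x)" "(g has_derivative g') (at 0)"
  shows "g' a \<bullet> b = g' b \<bullet> a"
proof (rule tendsto_unique)
  show "((\<lambda>s. (f (s *\<^sub>R a + s *\<^sub>R b) - f (s *\<^sub>R a) - f (s *\<^sub>R b) + f 0) / s\<^sup>2) \<longlongrightarrow> g' a \<bullet> b) (at_right 0)"
    using assms by (rule second_difference_limit)
  show "((\<lambda>s. (f (s *\<^sub>R a + s *\<^sub>R b) - f (s *\<^sub>R a) - f (s *\<^sub>R b) + f 0) / s\<^sup>2) \<longlongrightarrow> g' b \<bullet> a) (at_right 0)"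
    using second_difference_limit[OF assms, of b a] by (simp add: algebra_simps)
qed simp

section \<open>Tilted matrices and moment generating functions\<close>

lemma partial_deriv_eq:
  assumes "(f has_derivative f') (at x)"
  shows "partial_deriv i f x = f' (axis i 1)"
  unfolding partial_deriv_def
proof (rule DERIV_imp_deriv)
  interpret bounded_linear f' using assms by (rule has_derivative_bounded_linear)
  have "((\<lambda>s. x + s *\<^sub>R axis i 1) has_derivative (\<lambda>s. s *\<^sub>R axis i 1)) (at 0)"
    by (auto intro!: derivative_eq_intros)
  moreover have "(f has_derivative f') (at (x + 0 *\<^sub>R axis i 1))" using assms by simp
  ultimately have "((\<lambda>s. f (x + s *\<^sub>R axis i 1)) has_derivative (\<lambda>s. f' (s *\<^sub>R axis i 1))) (at 0)"
    by (rule has_derivative_compose)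
  then show "((\<lambda>s. f (x + s *\<^sub>R axis i 1)) has_real_derivative f' (axis i 1)) (at 0)"
    unfolding has_field_derivative_def by (simp add: scaleR mult.commute[of _ "f' (axis i 1)"] fun_eq_iff)
qed

lemma tilted_perron_smooth:
  fixes A :: "'l :: finite \<Rightarrow> real ^ 'm ^ 'm"
  assumes nn: "\<And>i p q. 0 \<le> A i $ p $ q" "\<And>p q. 0 \<le> B $ p $ q"
    and prim: "primitive (total_mat A B)"
    and y: "y = (\<lambda>t. pf_eigenvalue (tilted_mat A B t))"
  obtains u v g g' where "\<And>t. perron (tilted_mat A B t) (y t) (u t) (v t)"
    "isCont u 0" "isCont v 0"
    "\<And>x. ((\<lambda>t. ln (y t)) has_derivative (\<lambda>h. g x \<bullet> h)) (at x)" "(g has_derivative g') (at 0)"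
proof -
  have prim': "primitive (tilted_mat A B t)" for t
    using nn prim by (rule tilted_mat_primitive)
  have "\<exists>r u v. perron (tilted_mat A B t) r u v" for t
    using primitive_imp_perron[OF prim'] by metis
  then obtain r u v where "\<And>t. perron (tilted_mat A B t) (r t) (u t) (v t)" by metis
  then have P: "perron (tilted_mat A B t) (y t) (u t) (v t)" for t
    using pf_eigenvalue_eq[OF prim'] unfolding y by metis
  note D = perronD[OF P]
  have Pt: "perron (transpose (tilted_mat A B t)) (y t) (v t) (u t)" for t
    using P by (rule perron_transpose)
  have primt: "primitive (transpose (tilted_mat A B t))" for t
    using prim' by (rule primitive_transpose)
  have yd: "(y has_derivative (\<lambda>h. \<Sum>i\<in>UNIV. (exp (s $ i) * (u s \<bullet> (A i *v v s)) / (u s \<bullet> v s)) * h $ i)) (at s)" for s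
    using nn prim P by (rule tilted_perron_has_derivative)
  have ydiff: "y differentiable (at s)" for s using yd by (auto simp: differentiable_def)
  have vec: "(\<lambda>t. t $ i) differentiable (at (s :: real ^ 'l))" for i s
    by (rule differentiableI) (rule bounded_linear_imp_has_derivative[OF bounded_linear_vec_nth])
  have expdiff: "(\<lambda>t. exp (t $ i)) differentiable (at (s :: real ^ 'l))" for i s
    by (auto simp: differentiable_def
        intro!: exI has_derivative_exp bounded_linear_imp_has_derivative[OF bounded_linear_vec_nth])
  have Tdiff: "(\<lambda>t. tilted_mat A B t $ i $ j) differentiable (at s)" for i j s
    unfolding tilted_mat_nth using expdiff by auto
  have vdiff: "(\<lambda>t. v t $ k) differentiable (at s)" for k s
    by (rule perron_vector_differentiable[OF prim' P Tdiff ydiff])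
  have udiff: "(\<lambda>t. u t $ k) differentiable (at s)" for k s
    by (rule perron_vector_differentiable[OF primt Pt _ ydiff]) (simp add: transpose_def Tdiff)
  have uv: "isCont u 0" "isCont v 0"
    using udiff vdiff differentiable_imp_continuous_within unfolding isCont_def continuous_within
    by (blast intro: vec_tendstoI)+
  \<comment> \<open>\<open>G i\<close> is the \<open>i\<close>-th partial derivative of
    \<open>ln y\<close>. Written by means of \<open>u\<close>, \<open>v\<close> and
    \<open>y\<close>, all differentiable by now, it can be differentiated once more.\<close>
  define G where "G i s = exp (s $ i) * (u s \<bullet> (A i *v v s)) / (u s \<bullet> v s) / y s" for i s
  define g :: "real ^ 'l \<Rightarrow> real ^ 'l" where "g s = (\<Sum>i\<in>UNIV. G i s *\<^sub>R axis i 1)" for s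
  have gnth: "g s \<bullet> h = (\<Sum>i\<in>UNIV. G i s * h $ i)" for s h
    by (simp add: g_def inner_sum_left inner_axis')
  have Gdiff: "G i differentiable (at s)" for i s
    unfolding G_def inner_vec_sum matrix_vector_mult_def vec_lambda_beta
  proof (intro differentiable_divide differentiable_mult differentiable_sum expdiff udiff vdiff ydiff ballI)
    show "(\<Sum>i\<in>UNIV. u s $ i * v s $ i) \<noteq> 0" using D(9)[of s] by (simp add: inner_vec_sum)
    show "y s \<noteq> 0" using D(2)[of s] by simp
  qed simp_all
  have "g differentiable (at 0)"
    unfolding g_def using Gdiff by (intro differentiable_sum differentiable_scaleR ballI) auto
  then obtain g' where g': "(g has_derivative g') (at 0)" by (auto simp: differentiable_def)
  have "((\<lambda>t. ln (y t)) has_derivative (\<lambda>h. g x \<bullet> h)) (at x)" for x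
  proof -
    have "((\<lambda>t. ln (y t)) has_derivative (\<lambda>h. (\<Sum>i\<in>UNIV. (exp (x $ i) * (u x \<bullet> (A i *v v x)) / (u x \<bullet> v x)) * h $ i) * inverse (y x))) (at x)"
      using D(2)[of x] by (auto intro!: derivative_eq_intros yd simp: field_simps)
    also have "(\<lambda>h. (\<Sum>i\<in>UNIV. (exp (x $ i) * (u x \<bullet> (A i *v v x)) / (u x \<bullet> v x)) * h $ i) * inverse (y x)) = (\<lambda>h. g x \<bullet> h)"
      unfolding gnth G_def sum_distrib_right by (simp add: field_simps)
    finally show ?thesis .
  qed
  then show ?thesis using that P uv g' by blast
qed

section \<open>Generating functions over words\<close>

lemma finite_words: "finite {w :: 'a :: finite list. length w = n}"
  using finite_lists_length_eq[of "UNIV :: 'a set" n] by simp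

text \<open>The induction carries vectors and pairs with \<xi> only at the end: a new first letter
  multiplies by its matrix from the left, which a scalar statement for one fixed \<xi> could not
  absorb.\<close>

lemma word_generating_function:
  fixes A :: "'l :: finite \<Rightarrow> real ^ 'm ^ 'm"
  shows "(\<Sum>w | length w = n. word_weight \<xi> A B \<eta> w * exp (t \<bullet> symbol_counts w)) =
    \<xi> \<bullet> (mpow (tilted_mat A B t) n *v \<eta>)"
proof -
  have "(\<Sum>w | length w = n. exp (t \<bullet> symbol_counts w) *\<^sub>R (word_mat A B w *v \<eta>)) =
      mpow (tilted_mat A B t) n *v \<eta>"
  proof (induction n)
    case 0
    then show ?case by (simp add: symbol_counts_def word_mat_def inner_vec_sum)
  next
    case (Suc n)
    define e :: "'l option \<Rightarrow> real" where "e x = (case x of Some i \<Rightarrow> exp (t $ i) | None \<Rightarrow> 1)" for x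
    have words: "{w :: 'l option list. length w = Suc n} = (\<lambda>(x, w). x # w) ` (UNIV \<times> {w. length w = n})"
      by (auto simp: length_Suc_conv)
    have inj: "inj_on (\<lambda>(x, w). x # w) (UNIV \<times> {w :: 'l option list. length w = n})"
      by (auto simp: inj_on_def)
    have counts: "exp (t \<bullet> symbol_counts (x # w)) = e x * exp (t \<bullet> symbol_counts w)" for x w
    proof (cases x)
      case (Some i)
      have "symbol_counts (x # w) = axis i 1 + symbol_counts w"
        using Some by (auto simp: symbol_counts_def vec_eq_iff axis_def)
      then show ?thesis using Some by (simp add: e_def inner_add_right exp_add inner_axis)
    qed (simp add: e_def symbol_counts_def)
    have "(\<Sum>w | length w = Suc n. exp (t \<bullet> symbol_counts w) *\<^sub>R (word_mat A B w *v \<eta>)) =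
        (\<Sum>x\<in>UNIV. \<Sum>w | length w = n. (e x * exp (t \<bullet> symbol_counts w)) *\<^sub>R (word_mat A B (x # w) *v \<eta>))"
      unfolding words sum.reindex[OF inj] sum.cartesian_product
      by (simp add: counts case_prod_beta)
    also have "\<dots> = (\<Sum>x\<in>UNIV. e x *\<^sub>R (letter_mat A B x *v
        (\<Sum>w | length w = n. exp (t \<bullet> symbol_counts w) *\<^sub>R (word_mat A B w *v \<eta>))))"
      by (simp add: word_mat_def matrix_vector_mul_assoc[symmetric] scaleR_sum_right
          linear_sum[OF matrix_vector_mul_linear] matrix_vector_mult_scaleR)
    also have "\<dots> = tilted_mat A B t *v (mpow (tilted_mat A B t) n *v \<eta>)"
      unfolding Suc tilted_mat_mult
      by (simp add: UNIV_option_conv sum.reindex e_def letter_mat_def add.commute)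
    finally show ?case by (simp add: mpow_Suc matrix_vector_mul_assoc)
  qed
  from arg_cong[OF this, of "\<lambda>x. \<xi> \<bullet> x"] show ?thesis
    by (simp add: inner_sum_right word_weight_def mult.commute)
qed

text \<open>The limit does not depend on the sequence of tilts, so numerator and normalising
  constant share it and it cancels in their quotient.\<close>

lemma tilted_power_limit:
  fixes A :: "'l :: finite \<Rightarrow> real ^ 'm ^ 'm" and s :: "nat \<Rightarrow> real ^ 'l"
  assumes nn: "\<And>i p q. 0 \<le> A i $ p $ q" "\<And>p q. 0 \<le> B $ p $ q"
    and prim: "primitive (total_mat A B)"
    and P: "\<And>t. perron (tilted_mat A B t) (r t) (u t) (v t)"
    and uv: "isCont u 0" "isCont v 0" and s: "s \<longlonglongrightarrow> 0"
  shows "(\<lambda>n. \<xi> \<bullet> (mpow (tilted_mat A B (s n)) n *v \<eta>) / r (s n) ^ n)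
    \<longlonglongrightarrow> (u 0 \<bullet> \<eta>) / (u 0 \<bullet> v 0) * (\<xi> \<bullet> v 0)"
proof -
  note D = perronD[OF P]
  have r: "isCont r 0" using nn P by (rule tilted_perron_isCont)
  obtain k where k: "k \<ge> 1" "\<And>i j. 0 < mpow (total_mat A B) k $ i $ j"
    using prim by (auto simp: primitive_def)
  obtain e where e: "0 < e" "\<And>i j. e \<le> mpow (total_mat A B) k $ i $ j"
    using uniform_positive_lower_bound[of "\<lambda>i j. mpow (total_mat A B) k $ i $ j"] k(2) by metis
  \<comment> \<open>For \<open>norm (s n) < 1\<close> the \<open>k\<close>-th power loses at most
    the factor \<open>exp 1 ^ k\<close> against tilt 0, and eventually
    \<open>r (s n) < 2 * r 0\<close>; these two losses make up the denominator.\<close>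
  define e' where "e' = e / (exp 1 ^ k * (2 * r 0) ^ k)"
  have e': "0 < e'" using e D(2)[of 0] by (simp add: e'_def)
  have "(\<lambda>n. norm (s n)) \<longlonglongrightarrow> 0" using s by (rule tendsto_norm_zero)
  then have "\<forall>\<^sub>F n in sequentially. norm (s n) < 1" by (rule order_tendstoD) simp
  moreover have "(\<lambda>n. r (s n)) \<longlonglongrightarrow> r 0" using r s by (rule isCont_tendsto_compose)
  then have "\<forall>\<^sub>F n in sequentially. r (s n) < 2 * r 0"
    by (rule order_tendstoD) (use D(2)[of 0] in simp)
  ultimately have minor: "\<forall>\<^sub>F n in sequentially. \<forall>i j. e' * r (s n) ^ k \<le> mpow (tilted_mat A B (s n)) k $ i $ j"
  proof eventually_elim
    case (elim n)
    show ?case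
    proof (intro allI)
      fix i j
      let ?m = "mpow (tilted_mat A B (s n)) k $ i $ j"
      have m0: "0 \<le> ?m" by (intro mpow_nonneg D(1))
      have "e \<le> mpow (tilted_mat A B 0) k $ i $ j" using e by (simp add: tilted_mat_0)
      also have "\<dots> \<le> exp (norm (0 - s n)) ^ k * ?m"
        using mpow_mono[of "tilted_mat A B 0" "exp (norm (0 - s n))" "tilted_mat A B (s n)" k i j]
          tilted_mat_le[OF nn, where t = 0 and s = "s n"] D(1) by simp
      also have "\<dots> \<le> exp 1 ^ k * ?m"
        using elim(1) m0 by (intro mult_right_mono power_mono) auto
      finally have "e \<le> exp 1 ^ k * ?m" .
      then have "e / exp 1 ^ k \<le> ?m" by (simp add: field_simps)
      moreover have "e' * r (s n) ^ k \<le> e' * (2 * r 0) ^ k"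
        using elim(2) e' D(2)[of "s n"] by (intro mult_left_mono power_mono) auto
      moreover have "e' * (2 * r 0) ^ k = e / exp 1 ^ k"
        using D(2)[of 0] by (simp add: e'_def)
      ultimately show "e' * r (s n) ^ k \<le> ?m" by linarith
    qed
  qed
  have lim: "(\<lambda>n. (mpow (tilted_mat A B (s n)) n *v \<eta>) $ i / r (s n) ^ n)
      \<longlonglongrightarrow> (u 0 \<bullet> \<eta>) / (u 0 \<bullet> v 0) * v 0 $ i" for i
    using P isCont_tendsto_compose[OF uv(1) s] isCont_tendsto_compose[OF uv(2) s] D(3) D(4) k(1) e' minor
    by (rule perron_power_limit_sequence)
  have "(\<lambda>n. \<Sum>i\<in>UNIV. \<xi> $ i * ((mpow (tilted_mat A B (s n)) n *v \<eta>) $ i / r (s n) ^ n))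
      \<longlonglongrightarrow> (\<Sum>i\<in>UNIV. \<xi> $ i * ((u 0 \<bullet> \<eta>) / (u 0 \<bullet> v 0) * v 0 $ i))"
    by (intro tendsto_intros lim)
  then show ?thesis
    by (simp add: inner_vec_sum[of \<xi>] sum_distrib_left sum_divide_distrib mult_ac)
qed

section \<open>From moment generating functions to trigonometric polynomials\<close>

text \<open>Convergence on the real axis extends to the whole plane: the transforms are locally bounded
  entire functions, so by Montel's theorem they form a normal family, and every limit of a
  subsequence is determined by its values on the reals.\<close>

lemma mgf_limit_extends_to_complex:
  fixes p :: "nat \<Rightarrow> 'w \<Rightarrow> real" and Y :: "nat \<Rightarrow> 'w \<Rightarrow> real" and z :: complex
  assumes p: "\<And>n w. 0 \<le> p n w" and fin: "\<And>n. finite (W n)"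
    and lim: "\<And>x::real. (\<lambda>n. \<Sum>w\<in>W n. p n w * exp (x * Y n w)) \<longlonglongrightarrow> exp (x\<^sup>2 * q / 2)"
  shows "(\<lambda>n. \<Sum>w\<in>W n. of_real (p n w) * exp (z * of_real (Y n w))) \<longlonglongrightarrow> exp (z\<^sup>2 * of_real q / 2)"
proof (rule ccontr)
  define F where "F n z = (\<Sum>w\<in>W n. of_real (p n w) * exp (z * complex_of_real (Y n w)))" for n z
  define L where "L z = exp (z\<^sup>2 * complex_of_real q / 2)" for z
  assume "\<not> ?thesis"
  then obtain e where e: "e > 0" "\<not> (\<forall>\<^sub>F n in sequentially. dist (F n z) (L z) < e)"
    unfolding F_def L_def tendsto_iff by blast
  have "infinite {n. \<not> dist (F n z) (L z) < e}"
    using e(2) unfolding eventually_cofinite[symmetric] cofinite_eq_sequentially .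
  then obtain s :: "nat \<Rightarrow> nat" where s: "strict_mono s" "\<And>n. \<not> dist (F (s n) z) (L z) < e"
    using infinite_enumerate by blast
  have hol: "F n holomorphic_on UNIV" for n
    unfolding F_def by (intro holomorphic_intros)
  have real: "F n (of_real x) = of_real (\<Sum>w\<in>W n. p n w * exp (x * Y n w))" for n x
    by (simp add: F_def exp_of_real[symmetric])
  have bound: "\<exists>B. \<forall>n. \<forall>z\<in>K. norm (F n z) \<le> B" if K: "compact K" for K
  proof -
    obtain R where R: "\<And>z. z \<in> K \<Longrightarrow> norm z \<le> R"
      using compact_imp_bounded[OF K] unfolding bounded_iff by blast
    \<comment> \<open>For \<open>norm z \<le> R\<close> the modulus of \<open>exp (z Y)\<close> is
      \<open>exp (Re z Y)\<close>, dominated by the real exponentials at \<open>R\<close> and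
      \<open>- R\<close>, whose sums converge and so are bounded in \<open>n\<close>.\<close>
    define b where "b n = (\<Sum>w\<in>W n. p n w * exp (R * Y n w)) + (\<Sum>w\<in>W n. p n w * exp (- R * Y n w))" for n
    have "convergent b"
      unfolding b_def by (rule convergentI) (rule tendsto_add[OF lim lim])
    then obtain B where B: "\<And>n. norm (b n) \<le> B"
      using convergent_imp_Bseq BseqE by blast
    have "norm (F n z) \<le> B" if "z \<in> K" for n z
    proof -
      have "exp (Re z * Y n w) \<le> exp (R * Y n w) + exp (- R * Y n w)" for w
      proof -
        have "\<bar>Re z\<bar> \<le> R" using R[OF that] abs_Re_le_cmod[of z] by linarith
        then have "\<bar>Re z * Y n w\<bar> \<le> R * \<bar>Y n w\<bar>"
          unfolding abs_mult by (rule mult_right_mono) simp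
        then have "Re z * Y n w \<le> R * \<bar>Y n w\<bar>" by linarith
        then have "exp (Re z * Y n w) \<le> exp (R * \<bar>Y n w\<bar>)" by simp
        also have "\<dots> \<le> exp (R * Y n w) + exp (- R * Y n w)" by (simp add: abs_if)
        finally show ?thesis .
      qed
      then have "norm (of_real (p n w) * exp (z * complex_of_real (Y n w)))
          \<le> p n w * exp (R * Y n w) + p n w * exp (- R * Y n w)" for w
        using p[of n w] by (simp add: norm_mult distrib_left[symmetric] mult_left_mono)
      then have "norm (F n z) \<le> b n"
        unfolding F_def b_def sum.distrib[symmetric] by (intro sum_norm_le) auto
      then show ?thesis using B[of n] by simp
    qed
    then show ?thesis by blast
  qed
  obtain g r where g: "g holomorphic_on UNIV" "strict_mono r"
    "\<And>x. (\<lambda>n. F (s (r n)) x) \<longlonglongrightarrow> g x"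
  proof (rule Montel[of UNIV "range F" "\<lambda>n. F (s n)"])
    show "\<exists>B. \<forall>h\<in>range F. \<forall>z\<in>K. cmod (h z) \<le> B" if "compact K" "K \<subseteq> UNIV" for K
      using bound[OF that(1)] by blast
  qed (use hol in auto)
  have gL: "g (of_real x) - L (of_real x) = 0" for x
  proof -
    have "(\<lambda>n. F n (of_real x)) \<longlonglongrightarrow> of_real (exp (x\<^sup>2 * q / 2))"
      unfolding real using lim by (rule tendsto_of_real)
    then have "(\<lambda>n. F (s (r n)) (of_real x)) \<longlonglongrightarrow> of_real (exp (x\<^sup>2 * q / 2))"
      using LIMSEQ_subseq_LIMSEQ[OF _ strict_mono_o[OF s(1) g(2)]] by (fastforce simp: o_def)
    then have "g (of_real x) = of_real (exp (x\<^sup>2 * q / 2))" using g(3) LIMSEQ_unique by blast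
    then show ?thesis by (simp add: L_def exp_of_real[symmetric])
  qed
  have "g z - L z = 0"
  proof (rule analytic_continuation[of "\<lambda>z. g z - L z" UNIV "\<real>" 0 z])
    show "(\<lambda>z. g z - L z) holomorphic_on UNIV"
      unfolding L_def by (intro holomorphic_intros g(1)) simp
    show "(0::complex) islimpt \<real>"
      unfolding islimpt_approachable
    proof (intro allI impI)
      fix d :: real assume "d > 0"
      then show "\<exists>x'\<in>\<real>. x' \<noteq> 0 \<and> dist x' (0::complex) < d"
        by (intro bexI[of _ "of_real (d / 2)"]) auto
    qed
    show "g z - L z = 0" if "z \<in> \<real>" for z using gL that by (auto elim: Reals_cases)
  qed auto
  then have "(\<lambda>n. F (s (r n)) z) \<longlonglongrightarrow> L z" using g(3)[of z] by simp
  then have "\<forall>\<^sub>F n in sequentially. dist (F (s (r n)) z) (L z) < e" using e(1) by (rule tendstoD)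
  then show False using s(2) by simp
qed

text \<open>Take \<open>z = \<i>\<close> in the extended limit and rotate by \<open>cis b\<close>;
  other frequencies are absorbed into \<open>Y\<close>.\<close>

lemma mgf_limit_imp_cos_limit:
  fixes p :: "nat \<Rightarrow> 'w \<Rightarrow> real" and Y :: "nat \<Rightarrow> 'w \<Rightarrow> real"
  assumes "\<And>n w. 0 \<le> p n w" "\<And>n. finite (W n)"
    "\<And>x::real. (\<lambda>n. \<Sum>w\<in>W n. p n w * exp (x * Y n w)) \<longlonglongrightarrow> exp (x\<^sup>2 * q / 2)"
  shows "(\<lambda>n. \<Sum>w\<in>W n. p n w * cos (Y n w + b)) \<longlonglongrightarrow> cos b * exp (- q / 2)"
proof -
  have "(\<lambda>n. Re (cis b * (\<Sum>w\<in>W n. of_real (p n w) * exp (\<i> * of_real (Y n w)))))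
      \<longlonglongrightarrow> Re (cis b * exp (\<i>\<^sup>2 * of_real q / 2))"
    by (intro tendsto_intros mgf_limit_extends_to_complex assms)
  moreover have "Re (cis b * (\<Sum>w\<in>W n. of_real (p n w) * exp (\<i> * of_real (Y n w)))) =
      (\<Sum>w\<in>W n. p n w * cos (Y n w + b))" for n
  proof -
    have "Re (cis b * (complex_of_real (p n w) * exp (\<i> * of_real (Y n w)))) = p n w * cos (Y n w + b)" for w
      by (simp add: cis_conv_exp[symmetric] cos_add algebra_simps)
    then show ?thesis unfolding sum_distrib_left Re_sum by simp
  qed
  moreover have "exp (\<i>\<^sup>2 * complex_of_real q / 2) = of_real (exp (- q / 2))"
    by (simp add: exp_of_real[symmetric])
  ultimately show ?thesis by simp
qed

text \<open>With a free phase the one generator covers constants and sines, and product-to-sum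
  formulas make the class an algebra of real functions.\<close>

inductive trig_poly :: "('a::real_inner \<Rightarrow> real) \<Rightarrow> bool" where
  cosine: "trig_poly (\<lambda>x. c * cos (a \<bullet> x + b))"
| add: "trig_poly f \<Longrightarrow> trig_poly g \<Longrightarrow> trig_poly (\<lambda>x. f x + g x)"

lemma trig_poly_const: "trig_poly (\<lambda>x. c)"
  using trig_poly.cosine[of c 0 0] by simp

lemma trig_poly_sum: "finite I \<Longrightarrow> (\<And>i. i \<in> I \<Longrightarrow> trig_poly (f i)) \<Longrightarrow> trig_poly (\<lambda>x. \<Sum>i\<in>I. f i x)"
  by (induction I rule: finite_induct) (auto intro: trig_poly_const trig_poly.add)

lemma trig_poly_mult: "trig_poly f \<Longrightarrow> trig_poly g \<Longrightarrow> trig_poly (\<lambda>x. f x * g x)"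
proof (induction arbitrary: g rule: trig_poly.induct)
  case (cosine c a b)
  from cosine.prems show ?case
  proof (induction rule: trig_poly.induct)
    case (cosine c' a' b')
    have "(\<lambda>x. c * cos (a \<bullet> x + b) * (c' * cos (a' \<bullet> x + b'))) =
      (\<lambda>x. (c * c' / 2) * cos ((a - a') \<bullet> x + (b - b')) + (c * c' / 2) * cos ((a + a') \<bullet> x + (b + b')))"
    proof
      fix x
      have "cos ((a - a') \<bullet> x + (b - b')) = cos ((a \<bullet> x + b) - (a' \<bullet> x + b'))"
        "cos ((a + a') \<bullet> x + (b + b')) = cos ((a \<bullet> x + b) + (a' \<bullet> x + b'))"
        by (simp_all add: inner_diff_left inner_add_left algebra_simps)
      then show "c * cos (a \<bullet> x + b) * (c' * cos (a' \<bullet> x + b')) =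
        (c * c' / 2) * cos ((a - a') \<bullet> x + (b - b')) + (c * c' / 2) * cos ((a + a') \<bullet> x + (b + b'))"
        by (simp only: cos_add cos_diff) (simp add: field_simps)
    qed
    then show ?case by (simp only:) (intro trig_poly.intros)
  next
    case (add f g)
    then show ?case by (simp only: distrib_left) (rule trig_poly.add)
  qed
next
  case (add f1 f2)
  then show ?case unfolding distrib_right by (intro trig_poly.add add.IH add.prems)
qed

lemma trig_poly_measurable [measurable]: "trig_poly f \<Longrightarrow> f \<in> borel_measurable borel"
  for f :: "'a::euclidean_space \<Rightarrow> real"
  by (induction rule: trig_poly.induct) measurable

lemma trig_poly_bounded: "trig_poly f \<Longrightarrow> \<exists>B. \<forall>x. \<bar>f x\<bar> \<le> B"
proof (induction rule: trig_poly.induct)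
  case (cosine c a b)
  have "\<bar>c * cos (a \<bullet> x + b)\<bar> \<le> \<bar>c\<bar>" for x
    by (simp add: abs_mult mult_left_le)
  then show ?case by blast
next
  case (add f g)
  then obtain B C where "\<And>x. \<bar>f x\<bar> \<le> B" "\<And>x. \<bar>g x\<bar> \<le> C" by blast
  then have "\<bar>f x + g x\<bar> \<le> B + C" for x by (meson abs_triangle_ineq add_mono order_trans)
  then show ?case by blast
qed

lemma real_polynomial_sin_trig_poly:
  fixes f :: "real ^ 'l \<Rightarrow> real"
  assumes "real_polynomial_function f"
  shows "trig_poly (\<lambda>x :: real ^ 'l. f (\<chi> i. sin (x $ i / L)))"
  using assms
proof (induction rule: real_polynomial_function.induct)
  case (linear f)
  interpret bounded_linear f by fact
  \<comment> \<open>A linear \<open>f\<close> is determined by its values on the axes, and a sine is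
    a cosine with phase \<open>- (pi / 2)\<close>.\<close>
  have "f (\<chi> i. sin (x $ i / L)) = (\<Sum>i\<in>UNIV. f (axis i 1) * cos (axis i (1 / L) \<bullet> x + - (pi / 2)))" for x :: "real ^ 'l"
  proof -
    have "(\<chi> i. sin (x $ i / L)) = (\<Sum>i\<in>UNIV. sin (x $ i / L) *\<^sub>R axis i 1)"
      using basis_expansion[of "\<chi> i. sin (x $ i / L)"] by (simp add: scalar_mult_eq_scaleR)
    then have "f (\<chi> i. sin (x $ i / L)) = (\<Sum>i\<in>UNIV. sin (x $ i / L) * f (axis i 1))"
      by (simp add: sum scaleR)
    also have "\<dots> = (\<Sum>i\<in>UNIV. f (axis i 1) * cos (axis i (1 / L) \<bullet> x + - (pi / 2)))"
      by (intro sum.cong refl) (simp add: inner_axis' cos_diff)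
    finally show ?thesis .
  qed
  then show ?case by (simp only:) (intro trig_poly_sum trig_poly.cosine finite)
qed (auto intro: trig_poly_const trig_poly.add trig_poly_mult)

section \<open>Gaussian vectors and weak convergence\<close>

text \<open>The cosine clause gives the integrals of trigonometric polynomials directly. The
  variance is a function \<open>Q\<close>, so that the square of a linear form can be added without
  rebuilding a matrix.\<close>

definition centered_gaussian :: "(real ^ 'l \<Rightarrow> real) \<Rightarrow> (real ^ 'l) measure \<Rightarrow> bool" where
  "centered_gaussian Q N \<longleftrightarrow> prob_space N \<and> sets N = sets borel \<and>
     (\<forall>t. integrable N (\<lambda>x. exp (t \<bullet> x)) \<and> (\<integral>x. exp (t \<bullet> x) \<partial>N) = exp (Q t / 2)) \<and>
     (\<forall>a b. (\<integral>x. cos (a \<bullet> x + b) \<partial>N) = cos b * exp (- Q a / 2))"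

lemma std_normal_mgf:
  "integrable std_normal_distribution (\<lambda>z. exp (s * z))"
  "(\<integral>z. exp (s * z) \<partial>std_normal_distribution) = exp (s\<^sup>2 / 2)"
proof -
  \<comment> \<open>Completing the square: exponential tilting by \<open>s\<close> moves the mean
    from 0 to \<open>s\<close>.\<close>
  have *: "std_normal_density z * exp (s * z) = exp (s\<^sup>2 / 2) * normal_density s 1 z" for z
    unfolding normal_density_def
    by (simp add: exp_add[symmetric]) (simp add: power2_eq_square field_simps)
  show "integrable std_normal_distribution (\<lambda>z. exp (s * z))"
    by (subst integrable_density) (auto simp: *)
  show "(\<integral>z. exp (s * z) \<partial>std_normal_distribution) = exp (s\<^sup>2 / 2)"
    by (subst integral_density) (auto simp: *)
qed

lemma std_normal_cos:
  "(\<integral>z. cos (s * z + b) \<partial>std_normal_distribution) = cos b * exp (- s\<^sup>2 / 2)"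
proof -
  interpret real_distribution std_normal_distribution by (rule real_dist_normal_dist)
  have "integrable std_normal_distribution (\<lambda>z. iexp (s * z))" by (rule integrable_iexp) simp_all
  then have "(\<integral>z. Re (cis b * iexp (s * z)) \<partial>std_normal_distribution) =
      Re (cis b * (\<integral>z. iexp (s * z) \<partial>std_normal_distribution))"
    by (simp add: integral_Re)
  also have "(\<integral>z. iexp (s * z) \<partial>std_normal_distribution) = of_real (exp (- s\<^sup>2 / 2))"
    using fun_cong[OF char_std_normal_distribution, of s] by (simp add: char_def)
  also have "(\<lambda>z. Re (cis b * iexp (s * z))) = (\<lambda>z. cos (s * z + b))"
    by (simp add: fun_eq_iff Re_exp Im_exp cos_add algebra_simps)
  finally show ?thesis by simp
qed

text \<open>Take the law of \<open>x + z c\<close> with \<open>x\<close> distributed as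
  \<open>N\<close> and \<open>z\<close> an independent standard normal. Its projection on
  \<open>t\<close> is \<open>t \<bullet> x + (t \<bullet> c) z\<close>, so Fubini reduces both kinds
  of integral to one-dimensional ones in \<open>z\<close>.\<close>

lemma centered_gaussian_add:
  fixes c :: "real ^ 'l"
  assumes "centered_gaussian Q N"
  shows "\<exists>N'. centered_gaussian (\<lambda>t. Q t + (t \<bullet> c)\<^sup>2) N'"
proof -
  let ?S = "std_normal_distribution"
  from assms have N: "prob_space N" "sets N = sets borel"
    "\<And>t. integrable N (\<lambda>x. exp (t \<bullet> x))" "\<And>t. (\<integral>x. exp (t \<bullet> x) \<partial>N) = exp (Q t / 2)"
    "\<And>a b. (\<integral>x. cos (a \<bullet> x + b) \<partial>N) = cos b * exp (- Q a / 2)"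
    by (auto simp: centered_gaussian_def)
  interpret N: prob_space N by fact
  interpret S: real_distribution ?S by (rule real_dist_normal_dist)
  interpret P: pair_prob_space N ?S ..
  note [measurable_cong] = N(2)
  define f where "f = (\<lambda>(x, z). x + z *\<^sub>R c)"
  have f [measurable]: "f \<in> measurable (N \<Otimes>\<^sub>M ?S) borel" unfolding f_def by measurable
  define N' where "N' = distr (N \<Otimes>\<^sub>M ?S) borel f"
  have inner_f: "t \<bullet> f (x, z) = t \<bullet> x + (t \<bullet> c) * z" for t x z
    by (simp add: f_def inner_add_right mult.commute)
  have "integrable N' (\<lambda>x. exp (t \<bullet> x)) \<and> (\<integral>x. exp (t \<bullet> x) \<partial>N') = exp ((Q t + (t \<bullet> c)\<^sup>2) / 2)" for t
  proof -
    have eq: "(\<integral>z. exp (t \<bullet> f (x, z)) \<partial>?S) = exp (t \<bullet> x) * exp ((t \<bullet> c)\<^sup>2 / 2)" for x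
      unfolding inner_f exp_add by (simp add: std_normal_mgf)
    have int: "integrable (N \<Otimes>\<^sub>M ?S) (\<lambda>p. exp (t \<bullet> f p))"
    proof (rule P.Fubini_integrable)
      show "integrable N (\<lambda>x. \<integral>z. norm (exp (t \<bullet> f (x, z))) \<partial>?S)" using N(3) by (simp add: eq)
      show "AE x in N. integrable ?S (\<lambda>z. exp (t \<bullet> f (x, z)))"
        unfolding inner_f exp_add by (simp add: std_normal_mgf)
    qed measurable
    have "(\<integral>p. exp (t \<bullet> f p) \<partial>(N \<Otimes>\<^sub>M ?S)) = (\<integral>x. \<integral>z. exp (t \<bullet> f (x, z)) \<partial>?S \<partial>N)"
      using P.integral_fst'[OF int] by simp
    also have "\<dots> = exp ((Q t + (t \<bullet> c)\<^sup>2) / 2)"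
      unfolding eq by (simp add: N(4) exp_add add_divide_distrib)
    finally show ?thesis
      unfolding N'_def using int by (simp add: integrable_distr_eq integral_distr)
  qed
  moreover have "(\<integral>x. cos (a \<bullet> x + b) \<partial>N') = cos b * exp (- (Q a + (a \<bullet> c)\<^sup>2) / 2)" for a b
  proof -
    have int: "integrable (N \<Otimes>\<^sub>M ?S) (\<lambda>p. cos (a \<bullet> f p + b))"
      by (rule P.integrable_const_bound[of _ 1]) (auto simp: abs_cos_le_one)
    have "(\<integral>p. cos (a \<bullet> f p + b) \<partial>(N \<Otimes>\<^sub>M ?S)) = (\<integral>x. \<integral>z. cos (a \<bullet> f (x, z) + b) \<partial>?S \<partial>N)"
      using P.integral_fst'[OF int] by simp
    also have "\<dots> = (\<integral>x. cos (a \<bullet> x + b) * exp (- (a \<bullet> c)\<^sup>2 / 2) \<partial>N)"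
      using std_normal_cos[of "a \<bullet> c" "a \<bullet> _ + b"] by (simp add: inner_f add_ac)
    also have "\<dots> = cos b * exp (- (Q a + (a \<bullet> c)\<^sup>2) / 2)"
      using N(5) by (simp add: exp_add[symmetric] add_divide_distrib diff_divide_distrib)
    finally show ?thesis
      unfolding N'_def by (simp add: integral_distr)
  qed
  moreover have "prob_space N'" "sets N' = sets borel"
    unfolding N'_def by (auto intro: P.prob_space_distr)
  ultimately have "centered_gaussian (\<lambda>t. Q t + (t \<bullet> c)\<^sup>2) N'"
    by (simp add: centered_gaussian_def)
  then show ?thesis ..
qed

section \<open>Gaussian laws for positive semidefinite covariance matrices\<close>

lemma symmetric_matrix_inner: "transpose C = C \<Longrightarrow> x \<bullet> (C *v y) = y \<bullet> (C *v x)" for C :: "real ^ 'l ^ 'l"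
  by (metis dot_lmul_matrix inner_commute transpose_matrix_vector)

text \<open>To be read as a quadratic polynomial in \<open>x\<close> that is never negative: a
  vanishing leading coefficient kills the linear term, and otherwise the minimum is the form left
  after completing the square.\<close>

lemma psd_add_axis:
  fixes C :: "real ^ 'l ^ 'l"
  assumes "transpose C = C" "\<And>t. 0 \<le> t \<bullet> (C *v t)"
  shows "0 \<le> t \<bullet> (C *v t) + 2 * x * (C *v t) $ i + x\<^sup>2 * C $ i $ i"
proof -
  let ?e = "axis i 1 :: real ^ 'l"
  have "0 \<le> (t + x *\<^sub>R ?e) \<bullet> (C *v (t + x *\<^sub>R ?e))" by (rule assms)
  also have "\<dots> = t \<bullet> (C *v t) + 2 * x * (?e \<bullet> (C *v t)) + x\<^sup>2 * (?e \<bullet> (C *v ?e))"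
    using symmetric_matrix_inner[OF assms(1), of t ?e]
    by (simp add: matrix_vector_right_distrib matrix_vector_mult_scaleR inner_add_left inner_add_right power2_eq_square algebra_simps)
  also have "\<dots> = t \<bullet> (C *v t) + 2 * x * (C *v t) $ i + x\<^sup>2 * C $ i $ i"
    by (simp add: inner_axis' matrix_vector_mult_basis column_def)
  finally show ?thesis .
qed

text \<open>Completing squares one coordinate at a time writes the quadratic form as a sum of squares
  of linear forms, each of which is realised by one more independent standard normal.\<close>

lemma centered_gaussian_exists_supported:
  fixes C :: "real ^ 'l ^ 'l"
  assumes "finite S" "transpose C = C" "\<And>t. 0 \<le> t \<bullet> (C *v t)" "\<And>i j. i \<notin> S \<Longrightarrow> C $ i $ j = 0"
  shows "\<exists>N. centered_gaussian (\<lambda>t. t \<bullet> (C *v t)) N"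
  using assms
proof (induction S arbitrary: C rule: finite_induct)
  case empty
  then have C: "C = 0" by (simp add: vec_eq_iff)
  have "centered_gaussian (\<lambda>t. 0) (return borel (0 :: real ^ 'l))"
    unfolding centered_gaussian_def
    by (auto simp: integral_return prob_space_return integrable_iff_bounded nn_integral_return)
  then show ?case using C by auto
next
  case (insert i S)
  note sym = insert.prems(1) and psd = insert.prems(2) and supp = insert.prems(3)
  have symij: "C $ j $ k = C $ k $ j" for j k
    using sym by (metis transpose_def vec_lambda_beta)
  note ax = psd_add_axis[OF sym psd]
  have ii: "0 \<le> C $ i $ i" using ax[of 0 1 i] by simp
  show ?case
  proof (cases "C $ i $ i = 0")
    case True
    have "C $ j $ i = 0" for j
    proof (rule ccontr)
      assume j: "C $ j $ i \<noteq> 0"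
      define t where "t = (axis j 1 :: real ^ 'l)"
      have t: "(C *v t) $ i = C $ j $ i" by (simp add: t_def matrix_vector_mult_basis column_def symij)
      \<comment> \<open>With \<open>C $ i $ i = 0\<close> the polynomial is affine in
        \<open>x\<close>; this choice of \<open>x\<close> gives it the value -1.\<close>
      have "0 \<le> t \<bullet> (C *v t) + 2 * (- (t \<bullet> (C *v t) + 1) / (2 * C $ j $ i)) * C $ j $ i"
        using ax[of t "- (t \<bullet> (C *v t) + 1) / (2 * C $ j $ i)" i] True unfolding t by simp
      moreover have "2 * (- (t \<bullet> (C *v t) + 1) / (2 * C $ j $ i)) * C $ j $ i = - (t \<bullet> (C *v t) + 1)"
        using j by (simp add: field_simps)
      ultimately show False by linarith
    qed
    then have "C $ k $ j = 0" if "k \<notin> S" for k j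
      using supp[of k j] that symij[of k j] by (cases "k = i") auto
    then show ?thesis using insert.IH[OF sym psd] by blast
  next
    case False
    then have pos: "0 < C $ i $ i" using ii by simp
    \<comment> \<open>One Cholesky step: subtracting \<open>c $ j * c $ k\<close> leaves the Schur
      complement, which clears row and column \<open>i\<close> and stays semidefinite.\<close>
    define c where "c = (\<chi> j. C $ i $ j / sqrt (C $ i $ i))"
    define C' where "C' = (\<chi> j k. C $ j $ k - c $ j * c $ k)"
    have c: "t \<bullet> c = (C *v t) $ i / sqrt (C $ i $ i)" for t
      by (simp add: c_def inner_vec_def matrix_vector_mult_def sum_divide_distrib mult.commute)
    have C': "t \<bullet> (C' *v t) = t \<bullet> (C *v t) - (t \<bullet> c)\<^sup>2" for t
    proof -
      have "C' *v t = C *v t - (t \<bullet> c) *\<^sub>R c"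
        by (simp add: vec_eq_iff C'_def matrix_vector_mult_def inner_vec_def left_diff_distrib right_diff_distrib
            sum_subtractf sum_distrib_left mult_ac)
      then show ?thesis by (simp add: inner_diff_right power2_eq_square)
    qed
    have "0 \<le> t \<bullet> (C' *v t)" for t
    proof -
      have "0 \<le> t \<bullet> (C *v t) + 2 * (- (C *v t) $ i / C $ i $ i) * (C *v t) $ i + (- (C *v t) $ i / C $ i $ i)\<^sup>2 * C $ i $ i"
        by (rule ax)
      also have "\<dots> = t \<bullet> (C *v t) - ((C *v t) $ i)\<^sup>2 / C $ i $ i"
        using pos by (simp add: field_simps power2_eq_square)
      finally show ?thesis unfolding C' c using pos by (simp add: power_divide)
    qed
    moreover have "transpose C' = C'"
      by (simp add: transpose_def C'_def vec_eq_iff symij mult.commute)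
    moreover have "C' $ k $ j = 0" if "k \<notin> S" for k j
    proof (cases "k = i")
      case True
      then show ?thesis using pos by (simp add: C'_def c_def)
    next
      case False
      then have "C $ k $ j = 0" "C $ i $ k = 0" using supp[of k] that symij[of i k] by auto
      then show ?thesis by (simp add: C'_def c_def)
    qed
    ultimately obtain N where "centered_gaussian (\<lambda>t. t \<bullet> (C' *v t)) N"
      using insert.IH by blast
    from centered_gaussian_add[OF this, of c] show ?thesis by (simp add: C')
  qed
qed

text \<open>The exponential Markov inequality in pointwise form: the indicator of the complement of
  a box is dominated by a weight whose integrals are moment generating functions.\<close>

lemma sum_exp_ge_1:
  fixes x :: "real ^ 'l"
  assumes "M \<le> \<bar>x $ i\<bar>"
  shows "1 \<le> exp (- M) * (\<Sum>i\<in>UNIV. exp (x $ i) + exp (- (x $ i)))"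
proof -
  have "exp M \<le> exp \<bar>x $ i\<bar>" using assms by simp
  also have "\<dots> \<le> exp (x $ i) + exp (- (x $ i))" by (simp add: abs_if)
  also have "\<dots> \<le> (\<Sum>i\<in>UNIV. exp (x $ i) + exp (- (x $ i)))"
    by (intro member_le_sum) (auto intro: add_nonneg_nonneg)
  finally show ?thesis by (simp add: exp_minus field_simps)
qed

text \<open>Stone--Weierstrass in the variables \<open>sin (x_i / L)\<close>: these coordinates are injective on
  the box of half-width \<open>L pi / 2\<close>, and outside it the exponential weight takes over.\<close>

lemma trig_poly_approximation:
  fixes f :: "real ^ 'l \<Rightarrow> real"
  assumes f: "continuous_on UNIV f" "\<And>x. \<bar>f x\<bar> \<le> B" and e: "0 < e" and L: "0 < L"
  obtains h where "trig_poly h"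
    "\<And>x. \<bar>f x - h x\<bar> \<le> e + 2 * B * (exp (- (L * pi / 2)) * (\<Sum>i\<in>UNIV. exp (x $ i) + exp (- (x $ i))))"
proof -
  \<comment> \<open>\<open>g\<close> is \<open>f\<close> transported to the cube, so that
    \<open>g\<close> at the sines of \<open>x $ i / L\<close> recovers \<open>f x\<close> as long as
    \<open>x\<close> stays in the box.\<close>
  define g where "g u = f (\<chi> i. L * arcsin (u $ i))" for u
  let ?K = "cbox (- 1) 1 :: (real ^ 'l) set"
  have K: "u \<in> ?K \<longleftrightarrow> (\<forall>i. - 1 \<le> u $ i \<and> u $ i \<le> 1)" for u
    by (simp add: mem_box_cart)
  have "continuous_on ?K (\<lambda>u. \<chi> i. L * arcsin (u $ i))"
    using K by (intro continuous_intros continuous_on_vec_lambda) auto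
  then have "continuous_on ?K g"
    unfolding g_def by (rule continuous_on_compose2[OF f(1)]) simp
  then obtain q where q: "real_polynomial_function q" "\<And>u. u \<in> ?K \<Longrightarrow> \<bar>g u - q u\<bar> < e"
    using Stone_Weierstrass_real_polynomial_function[of ?K g e] e by auto
  have B: "0 \<le> B" using f(2)[of 0] by linarith
  show ?thesis
  proof (rule that)
    show "trig_poly (\<lambda>x. q (\<chi> i. sin (x $ i / L)))"
      using q(1) by (rule real_polynomial_sin_trig_poly)
    fix x :: "real ^ 'l"
    let ?u = "\<chi> i. sin (x $ i / L)" and ?V = "exp (- (L * pi / 2)) * (\<Sum>i\<in>UNIV. exp (x $ i) + exp (- (x $ i)))"
    have "?u \<in> ?K" by (simp add: K)
    then have gq: "\<bar>g ?u - q ?u\<bar> < e" by (rule q)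
    have V: "0 \<le> ?V" by (intro mult_nonneg_nonneg sum_nonneg add_nonneg_nonneg) auto
    have "\<bar>f x - g ?u\<bar> \<le> 2 * B * ?V"
    proof (cases "\<forall>i. \<bar>x $ i\<bar> \<le> L * pi / 2")
      case True
      have "L * arcsin (sin (x $ i / L)) = x $ i" for i
      proof -
        have "\<bar>x $ i / L\<bar> \<le> pi / 2" using True L by (simp add: abs_divide field_simps)
        then have "arcsin (sin (x $ i / L)) = x $ i / L" by (intro arcsin_sin) linarith+
        then show ?thesis using L by simp
      qed
      then show ?thesis using V B by (simp add: g_def vec_eq_iff vec_lambda_eta)
    next
      case False
      then obtain i where "L * pi / 2 < \<bar>x $ i\<bar>" by (auto simp: not_le)
      then have "1 \<le> ?V" by (rule sum_exp_ge_1[OF less_imp_le])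
      then have "2 * B * 1 \<le> 2 * B * ?V" using B by (intro mult_left_mono) auto
      moreover have "\<bar>f x - g ?u\<bar> \<le> B + B"
        unfolding g_def using f(2)[of x] f(2)[of "\<chi> i. L * arcsin (?u $ i)"] by linarith
      ultimately show ?thesis by linarith
    qed
    then show "\<bar>f x - q ?u\<bar> \<le> e + 2 * B * ?V" using gq by linarith
  qed
qed

text \<open>A trigonometric polynomial replaces \<open>f\<close> up to \<open>e / 5 + k V\<close>,
  and the mean of \<open>V\<close> is a finite sum of moment generating functions, hence under
  control along the sequence and for \<open>N\<close> alike.\<close>

lemma mgf_limit_imp_weak_limit:
  fixes p :: "nat \<Rightarrow> 'w \<Rightarrow> real" and X :: "nat \<Rightarrow> 'w \<Rightarrow> real ^ 'l" and C :: "real ^ 'l ^ 'l"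
  assumes p: "\<And>n w. 0 \<le> p n w" and fin: "\<And>n. finite (W n)"
    and p1: "\<forall>\<^sub>F n in sequentially. (\<Sum>w\<in>W n. p n w) = 1"
    and lim: "\<And>t. (\<lambda>n. \<Sum>w\<in>W n. p n w * exp (t \<bullet> X n w)) \<longlonglongrightarrow> exp ((t \<bullet> (C *v t)) / 2)"
    and N: "centered_gaussian (\<lambda>t. t \<bullet> (C *v t)) N"
    and f: "continuous_on UNIV f" "bounded (range f)"
  shows "(\<lambda>n. \<Sum>w\<in>W n. p n w * f (X n w)) \<longlonglongrightarrow> (\<integral>x. f x \<partial>N)"
proof -
  from N interpret N: prob_space N by (simp add: centered_gaussian_def)
  have N_sets [measurable_cong]: "sets N = sets borel" using N by (simp add: centered_gaussian_def)
  have N_mgf: "integrable N (\<lambda>x. exp (t \<bullet> x))" "(\<integral>x. exp (t \<bullet> x) \<partial>N) = exp ((t \<bullet> (C *v t)) / 2)"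
    and N_cos: "(\<integral>x. cos (t \<bullet> x + b) \<partial>N) = cos b * exp (- (t \<bullet> (C *v t)) / 2)" for t b
    using N by (simp_all add: centered_gaussian_def)
  have trig_int: "integrable N h" if h: "trig_poly h" for h
  proof -
    obtain B where "\<And>x. \<bar>h x\<bar> \<le> B" using trig_poly_bounded[OF h] by blast
    then show ?thesis
      using trig_poly_measurable[OF h] by (intro N.integrable_const_bound[of _ B]) auto
  qed
  have trig: "(\<lambda>n. \<Sum>w\<in>W n. p n w * h (X n w)) \<longlonglongrightarrow> (\<integral>x. h x \<partial>N)"
    if "trig_poly h" for h
    using that
    proof (induction rule: trig_poly.induct)
      case (cosine c a b)
      have "(\<lambda>n. \<Sum>w\<in>W n. p n w * cos (a \<bullet> X n w + b)) \<longlonglongrightarrow> cos b * exp (- (a \<bullet> (C *v a)) / 2)"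
      proof (rule mgf_limit_imp_cos_limit[OF p fin])
        show "(\<lambda>n. \<Sum>w\<in>W n. p n w * exp (x * (a \<bullet> X n w))) \<longlonglongrightarrow> exp (x\<^sup>2 * (a \<bullet> (C *v a)) / 2)" for x
          using lim[of "x *\<^sub>R a"] by (simp add: matrix_vector_mult_scaleR power2_eq_square mult_ac)
      qed
      from tendsto_mult_left[OF this, of c] show ?case
        by (simp add: sum_distrib_left N_cos mult_ac)
    next
      case (add f g)
      from tendsto_add[OF add.IH] show ?case
        using trig_int add.hyps by (simp add: distrib_left sum.distrib)
  qed
  obtain B where B: "\<And>x. \<bar>f x\<bar> \<le> B" using f(2) by (auto simp: bounded_iff)
  have f_meas [measurable]: "f \<in> borel_measurable borel" using f(1) by (rule borel_measurable_continuous_onI)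
  have f_int: "integrable N f" using B by (intro N.integrable_const_bound[of _ B]) auto
  let ?V = "\<lambda>x :: real ^ 'l. \<Sum>i\<in>UNIV. exp (x $ i) + exp (- (x $ i))"
  have V: "?V x = (\<Sum>i\<in>UNIV. exp (axis i 1 \<bullet> x) + exp (axis i (- 1) \<bullet> x))" for x
    by (simp add: inner_axis')
  define c where "c = (\<integral>x. ?V x \<partial>N)"
  have V_int: "integrable N ?V" unfolding V by (intro Bochner_Integration.integrable_sum Bochner_Integration.integrable_add N_mgf)
  have c: "c = (\<Sum>i\<in>UNIV. exp ((axis i 1 \<bullet> (C *v axis i 1)) / 2) + exp ((axis i (- 1) \<bullet> (C *v axis i (- 1))) / 2))"
    unfolding c_def V by (simp add: N_mgf)
  have "0 \<le> c" unfolding c by (intro sum_nonneg add_nonneg_nonneg) auto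
  have V_lim: "(\<lambda>n. \<Sum>w\<in>W n. p n w * ?V (X n w)) \<longlonglongrightarrow> c"
  proof -
    have "(\<lambda>n. \<Sum>i\<in>UNIV. (\<Sum>w\<in>W n. p n w * exp (axis i 1 \<bullet> X n w)) + (\<Sum>w\<in>W n. p n w * exp (axis i (- 1) \<bullet> X n w)))
      \<longlonglongrightarrow> c"
      unfolding c by (intro tendsto_sum tendsto_add lim)
    moreover have "(\<Sum>i\<in>UNIV. (\<Sum>w\<in>W n. p n w * exp (axis i 1 \<bullet> X n w)) + (\<Sum>w\<in>W n. p n w * exp (axis i (- 1) \<bullet> X n w)))
      = (\<Sum>w\<in>W n. p n w * ?V (X n w))" for n
      unfolding V sum_distrib_left by (subst sum.swap) (simp add: sum.distrib distrib_left)
    ultimately show ?thesis by simp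
  qed
  have B0: "0 \<le> B" using B[of 0] by linarith
  show ?thesis
  proof (rule tendstoI)
    fix e :: real assume e: "0 < e"
    \<comment> \<open>\<open>L\<close> is fixed before \<open>h\<close>, using only the limit
      \<open>c\<close> of the weighted sums; \<open>c + 1\<close> bounds these sums for large
      \<open>n\<close> as well as the integral under \<open>N\<close>. Of the five parts of
      \<open>e\<close>, each replacement of \<open>f\<close> by \<open>h\<close> takes two and the
      convergence for \<open>h\<close> takes one.\<close>
    have "((\<lambda>L. 2 * B * (exp (- (L * pi / 2)) * (c + 1))) \<longlongrightarrow> 0) at_top"
      by real_asymp
    then have "\<forall>\<^sub>F L in at_top. 2 * B * (exp (- (L * pi / 2)) * (c + 1)) < e / 5"
      using e by (intro order_tendstoD(2)) auto
    then obtain L where L: "0 < L" "2 * B * (exp (- (L * pi / 2)) * (c + 1)) < e / 5"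
      using eventually_happens'[OF trivial_limit_at_top_linorder eventually_conj[OF eventually_gt_at_top[of 0]]] by blast
    define k where "k = 2 * B * exp (- (L * pi / 2))"
    have k: "0 \<le> k" "k * (c + 1) < e / 5" using L B0 by (simp_all add: k_def mult_ac)
    obtain h where h: "trig_poly h" "\<And>x. \<bar>f x - h x\<bar> \<le> e / 5 + k * ?V x"
      using trig_poly_approximation[OF f(1) B _ L(1), of "e / 5"] e by (auto simp: k_def mult.assoc)
    have hN: "\<bar>(\<integral>x. f x \<partial>N) - (\<integral>x. h x \<partial>N)\<bar> \<le> 2 * (e / 5)"
    proof -
      have "\<bar>(\<integral>x. f x \<partial>N) - (\<integral>x. h x \<partial>N)\<bar> = \<bar>\<integral>x. f x - h x \<partial>N\<bar>"
        using f_int trig_int[OF h(1)] by simp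
      also have "\<dots> \<le> (\<integral>x. \<bar>f x - h x\<bar> \<partial>N)" by (rule integral_abs_bound)
      also have "\<dots> \<le> (\<integral>x. e / 5 + k * ?V x \<partial>N)"
        using h(2) f_int trig_int[OF h(1)] V_int by (intro integral_mono) auto
      also have "\<dots> = e / 5 + k * c" using V_int by (simp add: c_def N.prob_space del: integral_sum Bochner_Integration.integral_sum)
      finally show ?thesis using k by (simp add: distrib_left)
    qed
    have "\<forall>\<^sub>F n in sequentially. (\<Sum>w\<in>W n. p n w * ?V (X n w)) < c + 1"
      using V_lim by (rule order_tendstoD) simp
    moreover have "\<forall>\<^sub>F n in sequentially. dist (\<Sum>w\<in>W n. p n w * h (X n w)) (\<integral>x. h x \<partial>N) < e / 5"
      using trig[OF h(1)] e by (intro tendstoD) auto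
    moreover note p1
    ultimately show "\<forall>\<^sub>F n in sequentially. dist (\<Sum>w\<in>W n. p n w * f (X n w)) (\<integral>x. f x \<partial>N) < e"
    proof eventually_elim
      case (elim n)
      have *: "(\<Sum>w\<in>W n. p n w * (e / 5 + k * r w)) = e / 5 * (\<Sum>w\<in>W n. p n w) + k * (\<Sum>w\<in>W n. p n w * r w)" for r
        unfolding sum_distrib_left sum.distrib[symmetric] by (simp add: algebra_simps)
      have "\<bar>(\<Sum>w\<in>W n. p n w * f (X n w)) - (\<Sum>w\<in>W n. p n w * h (X n w))\<bar> =
          \<bar>\<Sum>w\<in>W n. p n w * (f (X n w) - h (X n w))\<bar>"
        by (simp add: sum_subtractf right_diff_distrib)
      also have "\<dots> \<le> (\<Sum>w\<in>W n. p n w * (e / 5 + k * ?V (X n w)))"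
        by (intro order_trans[OF sum_abs] sum_mono) (use h(2) p in \<open>simp add: abs_mult mult_left_mono\<close>)
      also have "\<dots> = e / 5 * (\<Sum>w\<in>W n. p n w) + k * (\<Sum>w\<in>W n. p n w * ?V (X n w))"
        by (rule *)
      also have "\<dots> \<le> e / 5 + k * (c + 1)"
        using elim(1,3) k(1) by (simp add: mult_left_mono)
      finally have "\<bar>(\<Sum>w\<in>W n. p n w * f (X n w)) - (\<Sum>w\<in>W n. p n w * h (X n w))\<bar> \<le> 2 * (e / 5)"
        using k(2) by simp
      then show ?case using elim(2) hN e unfolding dist_real_def by argo
    qed
  qed
qed

section \<open>The central limit theorem\<close>

lemma word_weight_nonneg:
  assumes "\<And>i p q. 0 \<le> A i $ p $ q" "\<And>p q. 0 \<le> B $ p $ q" "\<And>p. 0 \<le> \<xi> $ p" "\<And>p. 0 \<le> \<eta> $ p"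
  shows "0 \<le> word_weight \<xi> A B \<eta> w"
proof -
  have letter: "0 \<le> letter_mat A B x $ p $ q" for x p q
    using assms by (simp add: letter_mat_def split: option.split)
  have "0 \<le> (word_mat A B w *v \<eta>) $ p" for p
  proof (induction w arbitrary: p)
    case (Cons x w)
    have "word_mat A B (x # w) *v \<eta> = letter_mat A B x *v (word_mat A B w *v \<eta>)"
      by (simp add: word_mat_def matrix_vector_mul_assoc)
    then show ?case
      using letter Cons.IH by (simp add: matrix_vector_mult_def[of "letter_mat A B x"] sum_nonneg)
  qed (simp add: word_mat_def assms)
  then show ?thesis
    unfolding word_weight_def inner_vec_sum by (intro sum_nonneg mult_nonneg_nonneg assms)
qed

lemma inner_pos_nonneg_nonzero:
  fixes x y :: "real ^ 'm"
  assumes "\<And>i. 0 < x $ i" "\<And>i. 0 \<le> y $ i" "y \<noteq> 0"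
  shows "0 < x \<bullet> y"
proof -
  obtain i where "y $ i \<noteq> 0" using assms(3) by (auto simp: vec_eq_iff)
  then have "0 < x $ i * y $ i" using assms(1,2)[of i] by (simp add: less_le)
  then show ?thesis
    unfolding inner_vec_sum
    by (intro sum_pos2[of _ i]) (auto intro: mult_nonneg_nonneg less_imp_le assms)
qed

text \<open>With step \<open>1 / sqrt n\<close> the exponent is the quotient in
  \<open>second_order_expansion\<close> for \<open>ln y\<close>: \<open>a\<close> and
  \<open>b\<close> will be the eigenvalues at the tilt and at 0, and \<open>c\<close> the
  slope.\<close>

lemma power_ratio_eq_exp:
  assumes "n > 0" "0 < a" "0 < b"
  shows "a ^ n / b ^ n * exp (- (c * sqrt (real n))) =
    exp ((ln a - ln b - 1 / sqrt (real n) * c) / (1 / sqrt (real n))\<^sup>2)"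
proof -
  have e: "(ln a - ln b - 1 / sqrt (real n) * c) / (1 / sqrt (real n))\<^sup>2 =
      real n * ln a - real n * ln b - c * sqrt (real n)"
    using assms(1) by (simp add: power_divide field_simps real_sqrt_mult_self)
  have "a ^ n = exp (real n * ln a)" "b ^ n = exp (real n * ln b)"
    using assms by (simp_all add: exp_of_nat_mult)
  then show ?thesis unfolding e by (simp add: exp_diff exp_minus divide_inverse)
qed

theorem theorem3:
  fixes \<xi> \<eta> :: "real ^ 'm"
    and A :: "'l :: finite \<Rightarrow> real ^ 'm ^ 'm"
    and B :: "real ^ 'm ^ 'm"
    and lam :: real
    and y :: "real ^ 'l \<Rightarrow> real"
    and \<beta> :: "real ^ 'l"
    and \<Gamma> :: "real ^ 'l ^ 'l"
  assumes "linear_representation \<xi> A B \<eta>"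
    and "primitive (total_mat A B)"
    and "lam = pf_eigenvalue (total_mat A B)"
    and "y = (\<lambda>t. pf_eigenvalue (tilted_mat A B t))"
    and "\<beta> = (\<chi> i. partial_deriv i y 0 / lam)"
    and "\<Gamma> = (\<chi> i j. partial_deriv i (partial_deriv j (\<lambda>t. ln (y t))) 0)"
  shows "\<exists>N. gaussian_law 0 \<Gamma> N \<and>
    converges_in_distribution (word_measure \<xi> A B \<eta>)
      (\<lambda>n w. (1 / sqrt (real n)) *\<^sub>R (symbol_counts w - real n *\<^sub>R \<beta>)) N"
proof -
  have nn: "\<And>p. 0 \<le> \<xi> $ p" "\<And>p. 0 \<le> \<eta> $ p" "\<And>i p q. 0 \<le> A i $ p $ q" "\<And>p q. 0 \<le> B $ p $ q"
    and ev: "\<forall>\<^sub>F n in sequentially. \<exists>w. length w = n \<and> 0 < word_weight \<xi> A B \<eta> w"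
    using assms(1) by (auto simp: linear_representation_def)
  obtain u v g g' where P: "\<And>t. perron (tilted_mat A B t) (y t) (u t) (v t)"
    and uv: "isCont u 0" "isCont v 0"
    and g: "\<And>x. ((\<lambda>t. ln (y t)) has_derivative (\<lambda>h. g x \<bullet> h)) (at x)" "(g has_derivative g') (at 0)"
    using tilted_perron_smooth[OF nn(3,4) assms(2,4)] by metis
  note D = perronD[OF P]
  have lam: "lam = y 0" by (simp add: assms(3,4) tilted_mat_0)
  have "partial_deriv i y 0 = y 0 * g 0 $ i" for i
  proof -
    \<comment> \<open>The derivative is known for \<open>ln y\<close>; going back through
      \<open>y = exp (ln y)\<close> shows that \<beta> is the gradient of \<open>ln y\<close> at
      0.\<close>
    have "((\<lambda>t. exp (ln (y t))) has_derivative (\<lambda>h. exp (ln (y 0)) * (g 0 \<bullet> h))) (at 0)"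
      using has_derivative_exp[OF g(1)[of 0]] by (simp add: mult.commute)
    then have "(y has_derivative (\<lambda>h. y 0 * (g 0 \<bullet> h))) (at 0)" by (simp add: D)
    then show ?thesis by (simp add: partial_deriv_eq inner_axis)
  qed
  then have beta: "\<beta> = g 0" using D(2)[of 0] by (simp add: assms(5) lam vec_eq_iff)
  have "partial_deriv j (\<lambda>t. ln (y t)) = (\<lambda>x. g x $ j)" for j
    by (rule ext) (simp add: partial_deriv_eq[OF g(1)] inner_axis)
  moreover have "partial_deriv i (\<lambda>x. g x $ j) 0 = g' (axis i 1) $ j" for i j
    by (rule partial_deriv_eq[OF bounded_linear.has_derivative[OF bounded_linear_vec_nth g(2)]])
  ultimately have Gij: "\<Gamma> $ i $ j = g' (axis i 1) $ j" for i j
    by (simp add: assms(6))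
  note g'_sym = second_derivative_symmetric[OF g]
  have "g' (axis j 1) $ i = g' (axis i 1) $ j" for i j
    using g'_sym[of "axis j 1" "axis i 1"] by (simp add: inner_axis)
  then have G_sym: "transpose \<Gamma> = \<Gamma>"
    by (simp add: vec_eq_iff transpose_def Gij)
  have G_mult: "\<Gamma> *v t = g' t" for t
  proof -
    have "(\<Gamma> *v t) $ i = g' (axis i 1) \<bullet> t" for i
      by (simp add: matrix_vector_mult_def Gij inner_vec_sum)
    then show ?thesis by (simp add: g'_sym[of _ t] inner_axis vec_eq_iff)
  qed
  define W where "W n = {w :: 'l option list. length w = n}" for n
  define Z where "Z n = \<xi> \<bullet> (mpow (total_mat A B) n *v \<eta>)" for n
  define p where "p n w = word_weight \<xi> A B \<eta> w / Z n" for n w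
  define X where "X n w = (1 / sqrt (real n)) *\<^sub>R (symbol_counts w - real n *\<^sub>R \<beta>)" for n and w :: "'l option list"
  have fin: "finite (W n)" for n unfolding W_def by (rule finite_words)
  have weight: "0 \<le> word_weight \<xi> A B \<eta> w" for w using nn by (intro word_weight_nonneg)
  have Z: "Z n = (\<Sum>w\<in>W n. word_weight \<xi> A B \<eta> w)" for n
    using word_generating_function[of \<xi> A B \<eta> 0 n] by (simp add: W_def Z_def tilted_mat_0)
  have Z0: "0 \<le> Z n" for n unfolding Z by (intro sum_nonneg weight)
  have p: "0 \<le> p n w" for n w by (simp add: p_def weight Z0)
  have p1: "\<forall>\<^sub>F n in sequentially. (\<Sum>w\<in>W n. p n w) = 1"
    using ev
  proof eventually_elim
    case (elim n)
    then obtain w where "w \<in> W n" "0 < word_weight \<xi> A B \<eta> w" by (auto simp: W_def)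
    then have "0 < Z n" unfolding Z using fin weight by (intro sum_pos2[of _ w])
    then show ?case unfolding p_def by (simp add: sum_divide_distrib[symmetric] Z[symmetric])
  qed
  define K where "K = (u 0 \<bullet> \<eta>) / (u 0 \<bullet> v 0) * (\<xi> \<bullet> v 0)"
  have K: "0 < K"
  proof -
    obtain w where "0 < word_weight \<xi> A B \<eta> w"
      using eventually_happens'[OF sequentially_bot ev] by blast
    then have "\<xi> \<noteq> 0" "\<eta> \<noteq> 0" by (auto simp: word_weight_def)
    then have "0 < u 0 \<bullet> \<eta>" "0 < v 0 \<bullet> \<xi>" using D nn by (auto intro!: inner_pos_nonneg_nonzero)
    then show ?thesis using D(9)[of 0] by (simp add: K_def inner_commute)
  qed
  have sigma: "(\<lambda>n. 1 / sqrt (real n)) \<longlonglongrightarrow> 0" by real_asymp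
  have lim: "(\<lambda>n. \<Sum>w\<in>W n. p n w * exp (t \<bullet> X n w)) \<longlonglongrightarrow> exp ((t \<bullet> (\<Gamma> *v t)) / 2)" for t
  proof -
    define s where "s n = (1 / sqrt (real n)) *\<^sub>R t" for n
    have "s \<longlonglongrightarrow> 0 *\<^sub>R t" unfolding s_def by (intro tendsto_intros sigma)
    then have s: "s \<longlonglongrightarrow> 0" by simp
    have num: "(\<lambda>n. \<xi> \<bullet> (mpow (tilted_mat A B (s n)) n *v \<eta>) / y (s n) ^ n) \<longlonglongrightarrow> K"
      unfolding K_def using nn(3,4) assms(2) P uv s by (rule tilted_power_limit)
    have "(\<lambda>n. \<xi> \<bullet> (mpow (tilted_mat A B 0) n *v \<eta>) / y 0 ^ n) \<longlonglongrightarrow> K"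
      unfolding K_def using nn(3,4) assms(2) P uv tendsto_const by (rule tilted_power_limit)
    then have den: "(\<lambda>n. Z n / y 0 ^ n) \<longlonglongrightarrow> K" by (simp add: Z_def tilted_mat_0)
    have "filterlim (\<lambda>n. 1 / sqrt (real n)) (at_right 0) sequentially" by real_asymp
    then have expo: "(\<lambda>n. (ln (y (s n)) - ln (y 0) - 1 / sqrt (real n) * (g 0 \<bullet> t)) / (1 / sqrt (real n))\<^sup>2)
        \<longlonglongrightarrow> (g' t \<bullet> t) / 2"
      unfolding s_def by (rule filterlim_compose[OF second_order_expansion[OF g]])
    \<comment> \<open>The constants \<open>K\<close> cancel, and the centring by \<beta> is exactly
      the first-order term removed in the exponent.\<close>
    have "(\<lambda>n. (\<xi> \<bullet> (mpow (tilted_mat A B (s n)) n *v \<eta>) / y (s n) ^ n) / (Z n / y 0 ^ n) *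
        exp ((ln (y (s n)) - ln (y 0) - 1 / sqrt (real n) * (g 0 \<bullet> t)) / (1 / sqrt (real n))\<^sup>2))
        \<longlonglongrightarrow> K / K * exp ((g' t \<bullet> t) / 2)"
      using K by (intro tendsto_mult[OF tendsto_divide[OF num den] tendsto_exp[OF expo]]) simp
    moreover have "\<forall>\<^sub>F n in sequentially. (\<xi> \<bullet> (mpow (tilted_mat A B (s n)) n *v \<eta>) / y (s n) ^ n) / (Z n / y 0 ^ n) *
        exp ((ln (y (s n)) - ln (y 0) - 1 / sqrt (real n) * (g 0 \<bullet> t)) / (1 / sqrt (real n))\<^sup>2) =
        (\<Sum>w\<in>W n. p n w * exp (t \<bullet> X n w))"
      using eventually_gt_at_top[of 0]
    proof eventually_elim
      case (elim n)
      have X: "t \<bullet> X n w = s n \<bullet> symbol_counts w - (g 0 \<bullet> t) * sqrt (real n)" for w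
      proof -
        have "real n / sqrt (real n) = sqrt (real n)" by (simp add: real_div_sqrt)
        moreover have "t \<bullet> X n w = s n \<bullet> symbol_counts w - (g 0 \<bullet> t) * (real n / sqrt (real n))"
          by (simp add: X_def s_def beta inner_diff_right inner_commute right_diff_distrib)
        ultimately show ?thesis by simp
      qed
      have "(\<Sum>w\<in>W n. p n w * exp (t \<bullet> X n w)) =
          (\<Sum>w\<in>W n. word_weight \<xi> A B \<eta> w * exp (s n \<bullet> symbol_counts w)) / Z n * exp (- ((g 0 \<bullet> t) * sqrt (real n)))"
        unfolding sum_divide_distrib sum_distrib_right X p_def
        by (simp add: exp_diff exp_minus field_simps)
      also have "\<dots> = \<xi> \<bullet> (mpow (tilted_mat A B (s n)) n *v \<eta>) / Z n * exp (- ((g 0 \<bullet> t) * sqrt (real n)))"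
        unfolding W_def word_generating_function ..
      also have "\<dots> = (\<xi> \<bullet> (mpow (tilted_mat A B (s n)) n *v \<eta>) / y (s n) ^ n) / (Z n / y 0 ^ n) *
          (y (s n) ^ n / y 0 ^ n * exp (- ((g 0 \<bullet> t) * sqrt (real n))))"
        using D(2)[of "s n"] D(2)[of 0] by simp
      finally show ?case
        unfolding power_ratio_eq_exp[OF elim D(2)[of "s n"] D(2)[of 0], of "g 0 \<bullet> t"] by (rule sym)
    qed
    ultimately have "(\<lambda>n. \<Sum>w\<in>W n. p n w * exp (t \<bullet> X n w)) \<longlonglongrightarrow> K / K * exp ((g' t \<bullet> t) / 2)"
      by (rule Lim_transform_eventually)
    then show ?thesis using K by (simp add: G_mult inner_commute)
  qed
  \<comment> \<open>Semidefiniteness must precede the construction of the Gaussian law. It comes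
    from \<open>exp x + exp (- x) \<ge> 2\<close>: adding the limits at \<open>t\<close> and
    \<open>- t\<close> shows that \<open>exp ((t \<bullet> (\<Gamma> *v t)) / 2)\<close> is at least
    1.\<close>
  have psd: "0 \<le> t \<bullet> (\<Gamma> *v t)" for t
  proof -
    have "(\<lambda>n. (\<Sum>w\<in>W n. p n w * exp (t \<bullet> X n w)) + (\<Sum>w\<in>W n. p n w * exp (- t \<bullet> X n w)))
        \<longlonglongrightarrow> exp ((t \<bullet> (\<Gamma> *v t)) / 2) + exp ((t \<bullet> (\<Gamma> *v t)) / 2)"
      using tendsto_add[OF lim[of t] lim[of "- t"]] matrix_vector_mult_scaleR[of \<Gamma> "- 1" t] by simp
    moreover have "\<forall>\<^sub>F n in sequentially.
        2 \<le> (\<Sum>w\<in>W n. p n w * exp (t \<bullet> X n w)) + (\<Sum>w\<in>W n. p n w * exp (- t \<bullet> X n w))"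
      using p1
    proof eventually_elim
      case (elim n)
      have "2 \<le> exp x + exp (- x)" for x :: real
        using exp_ge_add_one_self[of x] exp_ge_add_one_self[of "- x"] by linarith
      then have "p n w * 2 \<le> p n w * (exp (t \<bullet> X n w) + exp (- t \<bullet> X n w))" for w
        using p[of n w] by (intro mult_left_mono) auto
      then have "(\<Sum>w\<in>W n. p n w * 2) \<le> (\<Sum>w\<in>W n. p n w * (exp (t \<bullet> X n w) + exp (- t \<bullet> X n w)))"
        by (intro sum_mono)
      then show ?case using elim by (simp add: distrib_left sum.distrib sum_distrib_right[symmetric])
    qed
    ultimately have "2 \<le> exp ((t \<bullet> (\<Gamma> *v t)) / 2) + exp ((t \<bullet> (\<Gamma> *v t)) / 2)"
      by (intro tendsto_lowerbound) auto
    then show ?thesis by simp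
  qed
  obtain N where N: "centered_gaussian (\<lambda>t. t \<bullet> (\<Gamma> *v t)) N"
    using centered_gaussian_exists_supported[of UNIV, OF _ G_sym psd] by auto
  have "gaussian_law 0 \<Gamma> N"
    using N G_sym psd by (auto simp: gaussian_law_def centered_gaussian_def)
  moreover have "converges_in_distribution (word_measure \<xi> A B \<eta>) X N"
    unfolding converges_in_distribution_def
  proof (intro allI impI)
    fix f :: "real ^ 'l \<Rightarrow> real"
    assume f: "continuous_on UNIV f" "bounded (range f)"
    \<comment> \<open>This holds for every \<open>n\<close>: where \<open>Z n = 0\<close>, division
      by zero makes all weights 0 on both sides.\<close>
    have "(\<integral>w. f (X n w) \<partial>word_measure \<xi> A B \<eta> n) = (\<Sum>w\<in>W n. p n w * f (X n w))" for n
      unfolding word_measure_def W_def[symmetric] Z_def[symmetric] p_def[symmetric]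
      by (subst lebesgue_integral_point_measure_finite) (auto simp: fin p)
    then show "(\<lambda>n. \<integral>w. f (X n w) \<partial>word_measure \<xi> A B \<eta> n) \<longlonglongrightarrow> (\<integral>x. f x \<partial>N)"
      using mgf_limit_imp_weak_limit[OF p fin p1 lim N f] by simp
  qed
  ultimately show ?thesis unfolding X_def by blast
qed

end
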